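(* Let $a,b\in\mathbb{R}^2$ be arbitrary points. For every point set $P=\{p_1,\dots,p_n\}\subset\mathbb{R}^2$ ($n\ge3$) in general position, the choice $f_{ij}=\det(a,p_i,p_j)\det(b,p_i,p_j)$ is valid for $P$; i.e. the polyhedron $\bar X_f(P)$ is a simple $(2n-3)$-dimensional polyhedron and $K\mapsto E(K)$ is an inclusion-reversing bijection from the nonempty faces of $\bar X_f(P)$ to the pointed non-crossing graphs embedded on $P$.
   Context: General position: no three points collinear. $\det(q_0,q_1,q_2)$ denotes the determinant of the $3\times3$ matrix with columns $(q_0,1),(q_1,1),(q_2,1)$. Graphs embedded on $P$ have straight-segment edges; non-crossing means edges meet only at common endpoints; a graph is pointed at a vertex $p$ if some angle at $p$ between consecutive incident edges exceeds $\pi$, and pointed if pointed at all vertices. Infinitesimal motions $v\in(\mathbb{R}^2)^n$ are normalized by $v_1^1=v_1^2=v_2^1=0$ (with $p_1,p_2$ having different $y$-coordinates). $\bar X_f(P)$ is the set of normalized $v$ with $\langle p_i-p_j,v_i-v_j\rangle\ge f_{ij}$ for all $i<j$; for a face $K$, $E(K)$ is the set of pairs $ij$ whose inequality is tight on all of $K$. A choice $f$ is called valid for $P$ if $K\mapsto E(K)$ is an inclusion-reversing bijection between nonempty faces of $\bar X_f(P)$ and pointed non-crossing graphs on $P$. *)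

theory Defs
  imports "HOL-Analysis.Analysis"
begin

text \<open>Points of the plane are modelled as complex numbers (x = Re, y = Im).
  A point set P = {p_i} is given by a labelling p :: 'n \<Rightarrow> complex with a
  finite index type 'n (n = CARD('n)); infinitesimal motions are vectors
  v :: complex^'n, v$i being the velocity of p i.\<close>

definition det3 :: "complex \<Rightarrow> complex \<Rightarrow> complex \<Rightarrow> real" where
  "det3 q0 q1 q2 =
     Re q0 * (Im q1 - Im q2) - Re q1 * (Im q0 - Im q2) + Re q2 * (Im q0 - Im q1)"
  \<comment> \<open>determinant of the 3x3 matrix with columns (q0,1),(q1,1),(q2,1)\<close>

definition general_position :: "('n \<Rightarrow> complex) \<Rightarrow> bool" where
  "general_position p \<longleftrightarrow> inj p \<and>
     (\<forall>i j k. i \<noteq> j \<and> j \<noteq> k \<and> i \<noteq> k \<longrightarrow> \<not> collinear {p i, p j, p k})"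

text \<open>Normalized infinitesimal motions satisfying all the inequalities;
  i1, i2 play the roles of p_1, p_2.\<close>
definition Xbar :: "('n::finite \<Rightarrow> complex) \<Rightarrow> 'n \<Rightarrow> 'n \<Rightarrow> ('n \<Rightarrow> 'n \<Rightarrow> real)
                    \<Rightarrow> (complex^'n) set" where
  "Xbar p i1 i2 f = {v. Re (v$i1) = 0 \<and> Im (v$i1) = 0 \<and> Re (v$i2) = 0 \<and>
      (\<forall>i j. i \<noteq> j \<longrightarrow> inner (p i - p j) (v$i - v$j) \<ge> f i j)}"

definition tight_pairs :: "('n::finite \<Rightarrow> complex) \<Rightarrow> ('n \<Rightarrow> 'n \<Rightarrow> real)
                          \<Rightarrow> (complex^'n) set \<Rightarrow> 'n set set" where
  "tight_pairs p f K = {{i, j} | i j. i \<noteq> j \<and>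
      (\<forall>v\<in>K. inner (p i - p j) (v$i - v$j) = f i j)}"

definition is_graph :: "'n set set \<Rightarrow> bool" where
  "is_graph G \<longleftrightarrow> (\<forall>e\<in>G. \<exists>i j. i \<noteq> j \<and> e = {i, j})"

definition non_crossing :: "('n \<Rightarrow> complex) \<Rightarrow> 'n set set \<Rightarrow> bool" where
  "non_crossing p G \<longleftrightarrow>
     (\<forall>i j k l. {i, j} \<in> G \<and> {k, l} \<in> G \<and> {i, j} \<noteq> {k, l} \<longrightarrow>
        closed_segment (p i) (p j) \<inter> closed_segment (p k) (p l) \<subseteq> p ` ({i, j} \<inter> {k, l}))"

definition neighbours :: "'n set set \<Rightarrow> 'n \<Rightarrow> 'n set" where
  "neighbours G i = {j. j \<noteq> i \<and> {i, j} \<in> G}"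

definition ccw_angle :: "('n \<Rightarrow> complex) \<Rightarrow> 'n \<Rightarrow> 'n \<Rightarrow> 'n \<Rightarrow> real" where
  "ccw_angle p i j k = Arg2pi ((p k - p i) / (p j - p i))"

text \<open>Pointed at p i: some angle between consecutive incident edges exceeds pi.
  With at most one incident edge the (single) angle is 2pi, so the vertex is pointed.
  Otherwise: there are incident edges ij and ik, with ik following ij in
  counterclockwise order (no incident edge strictly between them), and the
  counterclockwise angle from ij to ik exceeds pi.\<close>
definition pointed_at :: "('n \<Rightarrow> complex) \<Rightarrow> 'n set set \<Rightarrow> 'n \<Rightarrow> bool" where
  "pointed_at p G i \<longleftrightarrow>
     card (neighbours G i) \<le> 1 \<or>
     (\<exists>j\<in>neighbours G i. \<exists>k\<in>neighbours G i. j \<noteq> k \<and>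
        ccw_angle p i j k > pi \<and>
        (\<forall>l\<in>neighbours G i. l \<noteq> j \<longrightarrow> \<not> (ccw_angle p i j l < ccw_angle p i j k)))"

definition pointed :: "('n \<Rightarrow> complex) \<Rightarrow> 'n set set \<Rightarrow> bool" where
  "pointed p G \<longleftrightarrow> (\<forall>i. pointed_at p G i)"

definition pointed_noncrossing_graphs :: "('n \<Rightarrow> complex) \<Rightarrow> 'n set set set" where
  "pointed_noncrossing_graphs p = {G. is_graph G \<and> non_crossing p G \<and> pointed p G}"

definition valid_choice :: "('n::finite \<Rightarrow> complex) \<Rightarrow> 'n \<Rightarrow> 'n \<Rightarrow> ('n \<Rightarrow> 'n \<Rightarrow> real) \<Rightarrow> bool" where
  "valid_choice p i1 i2 f \<longleftrightarrow>
     (let X = Xbar p i1 i2 f; Fs = {K. K face_of X \<and> K \<noteq> {}} in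
        bij_betw (tight_pairs p f) Fs (pointed_noncrossing_graphs p) \<and>
        (\<forall>K1\<in>Fs. \<forall>K2\<in>Fs. K1 \<subseteq> K2 \<longleftrightarrow> tight_pairs p f K2 \<subseteq> tight_pairs p f K1))"

definition simple_polyhedron :: "'a::euclidean_space set \<Rightarrow> bool" where
  "simple_polyhedron X \<longleftrightarrow> polyhedron X \<and>
     (\<forall>x. {x} face_of X \<longrightarrow> int (card {F. F facet_of X \<and> x \<in> F}) = aff_dim X)"

end

theory Submission
  imports Defs
begin

text \<open>
  A vector \<open>v\<close> of the polyhedron makes the edges of a graph tight.  If \<open>\<mu>\<close> is an affine dependency of
  the points and \<open>s\<^sub>k\<^sub>l \<ge> 0\<close> are the slacks of \<open>v\<close>, then
  \<open>\<Sum>\<^sub>k\<^sub>l \<mu>\<^sub>k \<mu>\<^sub>l (s\<^sub>k\<^sub>l + det(c, p\<^sub>k, p\<^sub>l)\<^sup>2) = 0\<close> for every point \<open>c\<close>, because changing \<open>a\<close> and \<open>b\<close>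
  alters \<open>f\<close> only by an infinitesimal motion.  With \<open>c\<close> the intersection of two tight edges, or \<open>c\<close> a
  tight vertex in the convex hull of its neighbours, all terms have the same sign; hence tight graphs
  are non-crossing and pointed.

  Conversely let \<open>G\<close> be pointed and non-crossing.  By Farkas' lemma some \<open>v\<close> is tight exactly on \<open>G\<close>
  unless there is a self-stress \<open>w \<noteq> 0\<close> with \<open>w \<ge> 0\<close> off \<open>G\<close> and \<open>\<Sum> w\<^sub>i\<^sub>j f\<^sub>i\<^sub>j \<ge> 0\<close>.  The Airy stress
  function \<open>h\<close> of \<open>w\<close> (the Maxwell-Cremona lifting, also defined when edges cross) is continuous,
  piecewise linear and compactly supported, and \<open>\<Sum> w\<^sub>i\<^sub>j f\<^sub>i\<^sub>j\<close> is a positive multiple of \<open>\<integral> h\<close>.  Through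
  each point there is a line along which \<open>h\<close> is locally midpoint convex: along the edge of \<open>G\<close> through
  a point that is not a vertex, and at a vertex any line with all its \<open>G\<close>-neighbours strictly on one
  side.  A point of the maximum set farthest from the origin therefore contradicts \<open>max h > 0\<close>, so
  \<open>h \<le> 0\<close>, whence \<open>h = 0\<close> and \<open>w = 0\<close>.  The same argument shows that the edges of \<open>G\<close> impose
  independent conditions, so the face of \<open>G\<close> has codimension \<open>|G|\<close>.
\<close>

section \<open>The Airy stress function of a self-stress\<close>

text \<open>The absolute value is affine near \<open>c \<noteq> 0\<close>. In second differences of
  the Airy function this removes every edge whose line misses the base point.\<close>

lemma eventually_abs_second_difference:
  fixes c m :: real
  assumes "c \<noteq> 0"
  shows "\<forall>\<^sub>F t in at_right 0. \<bar>c + t * m\<bar> + \<bar>c - t * m\<bar> = 2 * \<bar>c\<bar>"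
proof -
  have 1: "((\<lambda>t. \<bar>t * m\<bar>) \<longlongrightarrow> \<bar>0 * m\<bar>) (at_right 0)"
    by (intro tendsto_intros)
  have "\<forall>\<^sub>F t in at_right 0. \<bar>t * m\<bar> < \<bar>c\<bar>"
    using order_tendstoD(2)[OF 1] assms by simp
  then show ?thesis
    by eventually_elim (auto simp: abs_if split: if_splits)
qed

text \<open>A self-stress on the complete graph over the points \<open>(x i, y i)\<close>. Distinct
  abscissae let a sweeping vertical line meet one vertex at a time; a shear will arrange
  this.\<close>

locale planar_stress =
  fixes x y :: "'n::finite \<Rightarrow> real" and w :: "'n \<Rightarrow> 'n \<Rightarrow> real"
  assumes inj_x: "inj x"
    and w_sym: "w i j = w j i"
    and equilibrium_x: "(\<Sum>j\<in>UNIV. w i j * (x j - x i)) = 0"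
    and equilibrium_y: "(\<Sum>j\<in>UNIV. w i j * (y j - y i)) = 0"
    and not_collinear:
      "i \<noteq> j \<Longrightarrow> j \<noteq> k \<Longrightarrow> i \<noteq> k \<Longrightarrow> (x j - x i) * (y k - y i) \<noteq> (x k - x i) * (y j - y i)"
begin

text \<open>Twice the signed area of the triangle with corners \<open>q\<close>, \<open>i\<close>,
  \<open>j\<close>; equally the moment about \<open>q\<close> of the vector from vertex
  \<open>i\<close> to vertex \<open>j\<close>, acting at \<open>i\<close>.\<close>

definition dd :: "'n \<Rightarrow> 'n \<Rightarrow> real \<times> real \<Rightarrow> real" where
  "dd i j q = (x i - fst q) * (y j - snd q) - (x j - fst q) * (y i - snd q)"

text \<open>The vertex set is kept apart from \<open>q\<close>: for fixed \<open>A\<close> the sum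
  is continuous in \<open>q\<close>, and only the change of \<open>A\<close> at a vertical line
  through a vertex needs care.\<close>

definition cut :: "'n set \<Rightarrow> real \<times> real \<Rightarrow> real" where
  "cut A q = (\<Sum>i\<in>A. \<Sum>j\<in>-A. w i j * \<bar>dd i j q\<bar>)"

text \<open>Up to a factor 2, the moment about \<open>q\<close> of the forces transmitted by the edges that meet the
  vertical ray from \<open>q\<close>; the absolute value makes the upward and the downward ray contribute
  equally, since the total moment of a cut vanishes.\<close>
definition airy :: "real \<times> real \<Rightarrow> real" where
  "airy q = cut {i. x i \<le> fst q} q"

lemma dd_antisym: "dd j i q = - dd i j q"
  by (simp add: dd_def)

lemma abs_dd_sym: "\<bar>dd j i q\<bar> = \<bar>dd i j q\<bar>"
  by (simp add: dd_antisym[of j i])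

lemma dd_self [simp]: "dd i i q = 0"
  by (simp add: dd_def)

lemma dd_line:
  "dd i j (q + t *\<^sub>R d) = dd i j q + t * (snd d * (x j - x i) - fst d * (y j - y i))"
  by (simp add: dd_def algebra_simps)

lemma dd_line_minus:
  "dd i j (q - t *\<^sub>R d) = dd i j q - t * (snd d * (x j - x i) - fst d * (y j - y i))"
  by (simp add: dd_def algebra_simps)

text \<open>Virtual work in one coordinate \<open>z\<close>: the part with \<open>u i\<close>
  collects the equilibrium at \<open>i\<close>, the part with \<open>u j\<close> that at
  \<open>j\<close>.\<close>

lemma sum_stress_zero:
  fixes z u :: "'n \<Rightarrow> real"
  assumes equilibrium: "\<And>i. (\<Sum>j\<in>UNIV. w i j * (z j - z i)) = 0"
  shows "(\<Sum>i\<in>UNIV. \<Sum>j\<in>UNIV. w i j * ((z i - z j) * (u i - u j))) = 0"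
proof -
  have 1: "(\<Sum>i\<in>UNIV. \<Sum>j\<in>UNIV. w i j * ((z i - z j) * u i)) = 0"
  proof (rule sum.neutral, rule ballI)
    fix i
    have "(\<Sum>j\<in>UNIV. w i j * ((z i - z j) * u i)) = - u i * (\<Sum>j\<in>UNIV. w i j * (z j - z i))"
      unfolding sum_distrib_left by (intro sum.cong refl) (simp add: algebra_simps)
    then show "(\<Sum>j\<in>UNIV. w i j * ((z i - z j) * u i)) = 0"
      by (simp add: equilibrium)
  qed
  have 2: "(\<Sum>i\<in>UNIV. \<Sum>j\<in>UNIV. w i j * ((z i - z j) * u j)) = 0"
  proof -
    have "(\<Sum>i\<in>UNIV. \<Sum>j\<in>UNIV. w i j * ((z i - z j) * u j))
        = (\<Sum>j\<in>UNIV. \<Sum>i\<in>UNIV. w i j * ((z i - z j) * u j))"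
      by (rule sum.swap)
    also have "\<dots> = - (\<Sum>j\<in>UNIV. \<Sum>i\<in>UNIV. w j i * ((z j - z i) * u j))"
      unfolding sum_negf[symmetric]
      by (intro sum.cong refl, subst w_sym) (simp add: algebra_simps)
    finally show ?thesis using 1 by simp
  qed
  have "(\<Sum>i\<in>UNIV. \<Sum>j\<in>UNIV. w i j * ((z i - z j) * (u i - u j)))
     = (\<Sum>i\<in>UNIV. \<Sum>j\<in>UNIV. w i j * ((z i - z j) * u i) - w i j * ((z i - z j) * u j))"
    by (intro sum.cong refl) (simp add: algebra_simps)
  then show ?thesis
    using 1 2 by (simp add: sum_subtractf)
qed

lemma sum_moment_zero: "(\<Sum>j\<in>UNIV. w i j * dd i j q) = 0"
proof -
  have "(\<Sum>j\<in>UNIV. w i j * dd i j q)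
      = (\<Sum>j\<in>UNIV. (x i - fst q) * (w i j * (y j - y i)) - (y i - snd q) * (w i j * (x j - x i)))"
    by (intro sum.cong refl) (simp add: dd_def algebra_simps)
  also have "\<dots> = 0"
    by (simp add: sum_subtractf sum_distrib_left[symmetric] equilibrium_x equilibrium_y)
  finally show ?thesis .
qed

text \<open>Edges inside \<open>A\<close> cancel in pairs, since \<open>w\<close> is symmetric and
  \<open>dd\<close> antisymmetric; what remains is a sum of moments at the vertices of
  \<open>A\<close>, each zero.\<close>

lemma cut_moment_zero: "(\<Sum>i\<in>A. \<Sum>j\<in>-A. w i j * dd i j q) = 0"
proof -
  have "(\<Sum>i\<in>A. \<Sum>j\<in>A. w i j * dd i j q) = (\<Sum>j\<in>A. \<Sum>i\<in>A. w i j * dd i j q)"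
    by (rule sum.swap)
  also have "\<dots> = - (\<Sum>i\<in>A. \<Sum>j\<in>A. w i j * dd i j q)"
    unfolding sum_negf[symmetric]
    by (intro sum.cong refl, subst w_sym, subst dd_antisym) simp
  finally have inner: "(\<Sum>i\<in>A. \<Sum>j\<in>A. w i j * dd i j q) = 0"
    by simp
  have "0 = (\<Sum>i\<in>A. \<Sum>j\<in>UNIV. w i j * dd i j q)"
    by (simp add: sum_moment_zero)
  also have "\<dots> = (\<Sum>i\<in>A. (\<Sum>j\<in>A. w i j * dd i j q) + (\<Sum>j\<in>-A. w i j * dd i j q))"
    by (intro sum.cong refl) (subst sum.union_disjoint[symmetric]; simp)
  finally show ?thesis
    using inner by (simp add: sum.distrib)
qed

lemma cut_insert:
  assumes "k \<notin> A"
  shows "cut (insert k A) q = cut A q + (\<Sum>j\<in>-insert k A. w k j * \<bar>dd k j q\<bar>)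
           - (\<Sum>i\<in>A. w k i * \<bar>dd k i q\<bar>)"
proof -
  have "cut A q = (\<Sum>i\<in>A. w i k * \<bar>dd i k q\<bar> + (\<Sum>j\<in>-insert k A. w i j * \<bar>dd i j q\<bar>))"
    unfolding cut_def
  proof (intro sum.cong refl)
    fix i
    have "- A = insert k (- insert k A)" using assms by auto
    then have "(\<Sum>j\<in>-A. w i j * \<bar>dd i j q\<bar>) = (\<Sum>j\<in>insert k (- insert k A). w i j * \<bar>dd i j q\<bar>)"
      by simp
    also have "\<dots> = w i k * \<bar>dd i k q\<bar> + (\<Sum>j\<in>-insert k A. w i j * \<bar>dd i j q\<bar>)"
      by (subst sum.insert) auto
    finally show "(\<Sum>j\<in>-A. w i j * \<bar>dd i j q\<bar>) = \<dots>" .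
  qed
  moreover have "(\<Sum>i\<in>A. w i k * \<bar>dd i k q\<bar>) = (\<Sum>i\<in>A. w k i * \<bar>dd k i q\<bar>)"
    by (intro sum.cong refl, subst w_sym, subst abs_dd_sym) simp
  ultimately show ?thesis
    using assms by (simp add: cut_def sum.distrib)
qed

lemma continuous_on_cut: "continuous_on S (cut A)"
  unfolding cut_def dd_def by (intro continuous_intros)

lemma le_eq_insert_less:
  assumes "x k = c"
  shows "{i. x i \<le> c} = insert k {i. x i < c}"
  using assms inj_x by (auto simp: inj_def order_le_less)

text \<open>On the vertical line through vertex \<open>k\<close>, \<open>dd k j q\<close> is
  \<open>snd q - y k\<close> times \<open>x j - x k\<close>, so moving \<open>k\<close> across the
  cut changes it by a multiple of the horizontal force at \<open>k\<close>. Hence the pieces of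
  \<open>airy\<close> agree on such lines.\<close>

lemma cut_vertical:
  assumes "fst q = c"
  shows "cut {i. x i < c} q = cut {i. x i \<le> c} q"
proof (cases "\<exists>k. x k = c")
  case False
  then have "{i. x i < c} = {i. x i \<le> c}" by (auto simp: order_le_less)
  then show ?thesis by simp
next
  case True
  then obtain k where k: "x k = c" by blast
  let ?A = "{i. x i < c}"
  have "(\<Sum>j\<in>-insert k ?A. w k j * \<bar>dd k j q\<bar>) - (\<Sum>i\<in>?A. w k i * \<bar>dd k i q\<bar>)
      = (\<Sum>j\<in>-?A. w k j * \<bar>dd k j q\<bar>) - (\<Sum>i\<in>?A. w k i * \<bar>dd k i q\<bar>)"
  proof -
    have "- ?A = insert k (- insert k ?A)" using k by auto
    then have "(\<Sum>j\<in>-?A. w k j * \<bar>dd k j q\<bar>) = (\<Sum>j\<in>insert k (- insert k ?A). w k j * \<bar>dd k j q\<bar>)"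
      by (rule arg_cong)
    also have "\<dots> = w k k * \<bar>dd k k q\<bar> + (\<Sum>j\<in>- insert k ?A. w k j * \<bar>dd k j q\<bar>)"
      by (subst sum.insert) auto
    finally show ?thesis by simp
  qed
  also have "\<dots> = (\<Sum>j\<in>-?A. \<bar>snd q - y k\<bar> * (w k j * (x j - x k)))
              + (\<Sum>j\<in>?A. \<bar>snd q - y k\<bar> * (w k j * (x j - x k)))"
  proof -
    have "dd k j q = (snd q - y k) * (x j - x k)" for j
      using assms k by (simp add: dd_def algebra_simps)
    then have *: "w k j * \<bar>dd k j q\<bar> = \<bar>snd q - y k\<bar> * (w k j * \<bar>x j - x k\<bar>)" for j
      by (simp add: abs_mult)
    have "(\<Sum>j\<in>-?A. w k j * \<bar>dd k j q\<bar>) = (\<Sum>j\<in>-?A. \<bar>snd q - y k\<bar> * (w k j * (x j - x k)))"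
      unfolding * using k by (intro sum.cong refl) auto
    moreover have "(\<Sum>j\<in>?A. w k j * \<bar>dd k j q\<bar>) = - (\<Sum>j\<in>?A. \<bar>snd q - y k\<bar> * (w k j * (x j - x k)))"
      unfolding * sum_negf[symmetric] using k by (intro sum.cong refl) (auto simp: algebra_simps)
    ultimately show ?thesis by simp
  qed
  also have "\<dots> = (\<Sum>j\<in>UNIV. \<bar>snd q - y k\<bar> * (w k j * (x j - x k)))"
    by (subst sum.union_disjoint[symmetric]) (auto simp: Un_commute)
  also have "\<dots> = 0"
    by (simp add: sum_distrib_left[symmetric] equilibrium_x)
  finally show ?thesis
    using cut_insert[of k ?A q] k by (simp add: le_eq_insert_less[OF k])
qed

lemma eventually_left_right_sets:
  "\<forall>\<^sub>F c' in at c. {i. x i \<le> c'} = (if c \<le> c' then {i. x i \<le> c} else {i. x i < c})"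
proof -
  have "\<forall>\<^sub>F c' in at c. \<forall>i\<in>UNIV. (x i < c \<longrightarrow> x i < c') \<and> (c < x i \<longrightarrow> c' < x i)"
  proof (intro eventually_ball_finite ballI)
    fix i
    have "\<forall>\<^sub>F c' in at c. x i < c \<longrightarrow> x i < c'"
      by (cases "x i < c") (auto intro: order_tendstoD(1)[OF tendsto_ident_at])
    moreover have "\<forall>\<^sub>F c' in at c. c < x i \<longrightarrow> c' < x i"
      by (cases "c < x i") (auto intro: order_tendstoD(2)[OF tendsto_ident_at])
    ultimately show "\<forall>\<^sub>F c' in at c. (x i < c \<longrightarrow> x i < c') \<and> (c < x i \<longrightarrow> c' < x i)"
      by eventually_elim auto
  qed simp
  then show ?thesis
  proof eventually_elim
    case (elim c')
    then have 1: "x i < c \<Longrightarrow> x i < c'" and 2: "c < x i \<Longrightarrow> c' < x i" for i by auto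
    have "x i \<le> c' \<longleftrightarrow> (if c \<le> c' then x i \<le> c else x i < c)" for i
      using 1[of i] 2[of i] by (cases "x i < c"; cases "c < x i") auto
    then show ?case by auto
  qed
qed

text \<open>Near \<open>q\<close> the function is one of two cuts, for the vertices weakly or
  strictly to the left of \<open>q\<close>; both are continuous and have the same value at
  \<open>q\<close>.\<close>

lemma isCont_airy: "isCont airy q"
proof -
  let ?c = "fst q"
  obtain e where e: "e > 0" and sets: "\<And>c'. c' \<noteq> ?c \<Longrightarrow> dist c' ?c < e \<Longrightarrow>
      {i. x i \<le> c'} = (if ?c \<le> c' then {i. x i \<le> ?c} else {i. x i < ?c})"
    using eventually_left_right_sets[of ?c] unfolding eventually_at by blast
  have cont: "(cut A \<longlongrightarrow> cut A q) (nhds q)" for A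
    using continuous_on_cut[of UNIV A]
    by (simp add: continuous_on_eq_continuous_at isCont_def tendsto_at_iff_tendsto_nhds del: split_paired_All)
  have L: "(cut {i. x i \<le> ?c} \<longlongrightarrow> airy q) (nhds q)"
    using cont[of "{i. x i \<le> ?c}"] by (simp add: airy_def)
  have R: "(cut {i. x i < ?c} \<longlongrightarrow> airy q) (nhds q)"
    using cont[of "{i. x i < ?c}"] by (simp add: airy_def cut_vertical[OF refl])
  have "(airy \<longlongrightarrow> airy q) (nhds q)"
  proof (rule tendstoI)
    fix r :: real assume "r > 0"
    have "\<forall>\<^sub>F q' in nhds q. dist q' q < e"
      using e by (auto simp: eventually_nhds_metric)
    then show "\<forall>\<^sub>F q' in nhds q. dist (airy q') (airy q) < r"
      using tendstoD[OF L \<open>r > 0\<close>] tendstoD[OF R \<open>r > 0\<close>]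
    proof eventually_elim
      case (elim q')
      have d: "dist (fst q') ?c < e"
        using dist_fst_le[of q' q] elim(1) by linarith
      show ?case
      proof (cases "fst q' < ?c")
        case True
        then have "airy q' = cut {i. x i < ?c} q'"
          using sets[of "fst q'"] d by (auto simp: airy_def)
        then show ?thesis using elim by simp
      next
        case False
        then have "airy q' = cut {i. x i \<le> ?c} q'"
          using sets[of "fst q'"] d by (cases "fst q' = ?c") (auto simp: airy_def)
        then show ?thesis using elim by simp
      qed
    qed
  qed
  then show ?thesis by (simp add: isCont_def tendsto_at_iff_tendsto_nhds)
qed

end

section \<open>The maximum principle\<close>

text \<open>A single nonzero \<open>d\<close> at each point suffices. A positive maximum would be
  attained on a compact set; at its farthest point \<open>u\<close> both \<open>u + d\<close> and
  \<open>u - d\<close> are maximizers as well, and the parallelogram law makes one of them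
  longer.\<close>

lemma midpoint_max_principle:
  fixes h :: "'a::euclidean_space \<Rightarrow> real"
  assumes cont: "continuous_on UNIV h"
    and supp: "\<And>q. norm q > R \<Longrightarrow> h q \<le> 0"
    and mid: "\<And>q. \<exists>d. d \<noteq> 0 \<and> 2 * h q \<le> h (q + d) + h (q - d)"
  shows "h q \<le> 0"
proof (rule ccontr)
  assume "\<not> h q \<le> 0"
  then have q: "q \<in> cball 0 R" "h q > 0" using supp[of q] by force+
  obtain z where z: "z \<in> cball 0 R" "\<And>u. u \<in> cball 0 R \<Longrightarrow> h u \<le> h z"
    using continuous_attains_sup[OF compact_cball _ continuous_on_subset[OF cont subset_UNIV]] q(1)
    by (metis empty_iff)
  have pos: "h z > 0" using z(2)[OF q(1)] q(2) by simp
  have max: "h u \<le> h z" for u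
    using z(2)[of u] supp[of u] pos by (cases "norm u > R") auto
  define M where "M = {u. h u = h z}"
  have "closed M" unfolding M_def
    using continuous_closed_preimage_constant[of UNIV h "h z"] cont by simp
  moreover have "M \<subseteq> cball 0 R"
    unfolding M_def using supp pos by (force simp: not_less[symmetric])
  ultimately have "compact M"
    by (meson bounded_cball bounded_subset compact_eq_bounded_closed)
  moreover have "z \<in> M" by (simp add: M_def)
  ultimately obtain u where u: "u \<in> M" "\<And>u'. u' \<in> M \<Longrightarrow> norm u' \<le> norm u"
    using continuous_attains_sup[of M norm] continuous_on_norm_id by blast
  obtain d where d: "d \<noteq> 0" "2 * h u \<le> h (u + d) + h (u - d)" using mid by blast
  have "u + d \<in> M" "u - d \<in> M"
    using u(1) d(2) max[of "u + d"] max[of "u - d"] by (auto simp: M_def)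
  then have "norm (u + d) ^ 2 \<le> norm u ^ 2" "norm (u - d) ^ 2 \<le> norm u ^ 2"
    using u(2) by (auto intro: power_mono)
  moreover have "norm (u + d) ^ 2 + norm (u - d) ^ 2 = 2 * norm u ^ 2 + 2 * norm d ^ 2"
    by (simp add: power2_norm_eq_inner algebra_simps inner_commute)
  moreover have "norm d ^ 2 > 0" using d(1) by simp
  ultimately show False by linarith
qed

section \<open>Support and local convexity of the Airy function\<close>

context planar_stress
begin

lemma airy_support:
  obtains R where "\<And>i. \<bar>x i\<bar> < R" "\<And>i. \<bar>y i\<bar> < R"
    "\<And>q. R \<le> \<bar>fst q\<bar> \<or> R \<le> \<bar>snd q\<bar> \<Longrightarrow> airy q = 0"
proof
  define R where "R = Max (range (\<lambda>i. \<bar>x i\<bar> + \<bar>y i\<bar>)) + 1"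
  have "\<bar>x i\<bar> + \<bar>y i\<bar> \<le> Max (range (\<lambda>i. \<bar>x i\<bar> + \<bar>y i\<bar>))" for i
    by (intro Max_ge) auto
  then have *: "\<bar>x i\<bar> + \<bar>y i\<bar> < R" for i
    unfolding R_def by (meson less_add_one order_le_less_trans)
  show X: "\<bar>x i\<bar> < R" for i using *[of i] by linarith
  show Y: "\<bar>y i\<bar> < R" for i using *[of i] by linarith
  show "airy q = 0" if out: "R \<le> \<bar>fst q\<bar> \<or> R \<le> \<bar>snd q\<bar>" for q
  proof -
    let ?A = "{i. x i \<le> fst q}"
    consider "fst q \<le> - R" | "fst q \<ge> R" | "snd q \<ge> R" | "snd q \<le> - R"
      using out by linarith
    then show ?thesis
    proof cases
      case 1
      have "\<not> x i \<le> fst q" for i using 1 X[of i] by linarith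
      then have "?A = {}" by simp
      then show ?thesis by (simp add: airy_def cut_def)
    next
      case 2
      have "x i \<le> fst q" for i using 2 X[of i] by linarith
      then have "?A = UNIV" by simp
      then show ?thesis by (simp add: airy_def cut_def)
    next
      case 3
      have "\<bar>dd i j q\<bar> = dd i j q" if "i \<in> ?A" "j \<in> - ?A" for i j
      proof -
        have "(x i - fst q) * (y j - snd q) \<ge> 0"
          using that 3 Y[of j] by (intro mult_nonpos_nonpos) auto
        moreover have "(x j - fst q) * (y i - snd q) \<le> 0"
          using that 3 Y[of i] by (intro mult_nonneg_nonpos) auto
        ultimately show ?thesis by (simp add: dd_def)
      qed
      then have "airy q = (\<Sum>i\<in>?A. \<Sum>j\<in>-?A. w i j * dd i j q)"
        unfolding airy_def cut_def by (intro sum.cong refl) simp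
      then show ?thesis by (simp add: cut_moment_zero)
    next
      case 4
      have "\<bar>dd i j q\<bar> = - dd i j q" if "i \<in> ?A" "j \<in> - ?A" for i j
      proof -
        have "(x i - fst q) * (y j - snd q) \<le> 0"
          using that 4 Y[of j] by (intro mult_nonpos_nonneg) auto
        moreover have "(x j - fst q) * (y i - snd q) \<ge> 0"
          using that 4 Y[of i] by (intro mult_nonneg_nonneg) auto
        ultimately show ?thesis by (simp add: dd_def)
      qed
      then have "airy q = - (\<Sum>i\<in>?A. \<Sum>j\<in>-?A. w i j * dd i j q)"
        unfolding airy_def cut_def sum_negf[symmetric] by (intro sum.cong refl) simp
      then show ?thesis by (simp add: cut_moment_zero)
    qed
  qed
qed

text \<open>Extends \<open>cut_vertical\<close> from the vertical line to every short ray from a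
  non-vertex \<open>q\<close>. Near \<open>q\<close> the sign of \<open>dd k j\<close> is that of
  \<open>(snd q - y k) * (x j - x k)\<close>, so moving \<open>k\<close> across the cut changes it
  by the total moment at \<open>k\<close>, up to sign.\<close>

lemma eventually_cut_swap:
  assumes nv: "\<And>k. (x k, y k) \<noteq> q"
  shows "\<forall>\<^sub>F t in at_right 0.
    cut {i. x i < fst q} (q + t *\<^sub>R d) = cut {i. x i \<le> fst q} (q + t *\<^sub>R d)"
proof (cases "\<exists>k. x k = fst q")
  case False
  then have "{i. x i < fst q} = {i. x i \<le> fst q}" by (auto simp: order_le_less)
  then show ?thesis by simp
next
  case True
  then obtain k where k: "x k = fst q" by blast
  let ?A = "{i. x i < fst q}" and ?s = "sgn (snd q - y k)"
  have yk: "snd q \<noteq> y k" using nv[of k] k by (auto simp: prod_eq_iff)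
  have "\<forall>\<^sub>F t in at_right 0. \<forall>j\<in>-{k}.
      \<bar>dd k j (q + t *\<^sub>R d)\<bar> * sgn (x j - x k) = ?s * dd k j (q + t *\<^sub>R d)"
  proof (intro eventually_ball_finite ballI)
    fix j assume "j \<in> -{k}"
    then have xj: "x j \<noteq> x k" using inj_x by (auto simp: inj_def)
    let ?D = "\<lambda>t. dd k j (q + t *\<^sub>R d)"
    have D: "dd k j q = (snd q - y k) * (x j - x k)"
      using k by (simp add: dd_def algebra_simps)
    have lim: "(?D \<longlongrightarrow> dd k j q) (at_right 0)"
      unfolding dd_line by (auto intro!: tendsto_eq_intros)
    consider "dd k j q > 0" | "dd k j q < 0" 
      using D xj yk by (cases "dd k j q" "0::real" rule: linorder_cases) auto
    then have "\<forall>\<^sub>F t in at_right 0. sgn (?D t) = sgn (dd k j q)"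
    proof cases
      case 1
      have "\<forall>\<^sub>F t in at_right 0. ?D t > 0" using order_tendstoD(1)[OF lim 1] .
      then show ?thesis by eventually_elim (use 1 in simp)
    next
      case 2
      have "\<forall>\<^sub>F t in at_right 0. ?D t < 0" using order_tendstoD(2)[OF lim 2] .
      then show ?thesis by eventually_elim (use 2 in simp)
    qed
    then show "\<forall>\<^sub>F t in at_right 0. \<bar>?D t\<bar> * sgn (x j - x k) = ?s * ?D t"
    proof eventually_elim
      case (elim t)
      have "?s * ?D t = ?s * (sgn (?D t) * \<bar>?D t\<bar>)" by (simp add: sgn_mult_abs)
      also have "\<dots> = (?s * ?s) * sgn (x j - x k) * \<bar>?D t\<bar>"
        unfolding elim D sgn_mult by simp
      also have "?s * ?s = 1" using yk by (simp add: sgn_if)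
      finally show ?case by simp
    qed
  qed simp
  then show ?thesis
  proof eventually_elim
    case (elim t)
    let ?q = "q + t *\<^sub>R d"
    have "(\<Sum>j\<in>-insert k ?A. w k j * \<bar>dd k j ?q\<bar>) = (\<Sum>j\<in>-insert k ?A. ?s * (w k j * dd k j ?q))"
    proof (intro sum.cong refl)
      fix j assume j: "j \<in> -insert k ?A"
      then have "x j \<noteq> x k" using inj_x by (auto simp: inj_def)
      then have "x j > x k" using j k by auto
      moreover have "\<bar>dd k j ?q\<bar> * sgn (x j - x k) = ?s * dd k j ?q" using elim j by blast
      ultimately show "w k j * \<bar>dd k j ?q\<bar> = ?s * (w k j * dd k j ?q)"
        by simp
    qed
    moreover have "(\<Sum>j\<in>?A. w k j * \<bar>dd k j ?q\<bar>) = - (\<Sum>j\<in>?A. ?s * (w k j * dd k j ?q))"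
      unfolding sum_negf[symmetric]
    proof (intro sum.cong refl)
      fix j assume j: "j \<in> ?A"
      then have "x j < x k" "j \<noteq> k" using k by auto
      moreover from this have "\<bar>dd k j ?q\<bar> * sgn (x j - x k) = ?s * dd k j ?q" using elim by blast
      ultimately have "\<bar>dd k j ?q\<bar> = - (?s * dd k j ?q)" by simp
      then show "w k j * \<bar>dd k j ?q\<bar> = - (?s * (w k j * dd k j ?q))"
        by (simp add: algebra_simps)
    qed
    moreover have "(\<Sum>j\<in>-insert k ?A. ?s * (w k j * dd k j ?q)) + (\<Sum>j\<in>?A. ?s * (w k j * dd k j ?q)) = 0"
    proof -
      have "(\<Sum>j\<in>-insert k ?A. ?s * (w k j * dd k j ?q)) + (\<Sum>j\<in>?A. ?s * (w k j * dd k j ?q))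
         = (\<Sum>j\<in>-insert k ?A \<union> ?A. ?s * (w k j * dd k j ?q))"
        by (intro sum.union_disjoint[symmetric]) auto
      also have "-insert k ?A \<union> ?A = UNIV - {k}" using k by auto
      also have "(\<Sum>j\<in>UNIV - {k}. ?s * (w k j * dd k j ?q)) = (\<Sum>j\<in>UNIV. ?s * (w k j * dd k j ?q))"
        by (intro sum.mono_neutral_left) auto
      also have "\<dots> = 0" by (simp add: sum_distrib_left[symmetric] sum_moment_zero)
      finally show ?thesis .
    qed
    ultimately show ?case
      using cut_insert[of k ?A ?q] k by (simp add: le_eq_insert_less[OF k])
  qed
qed

lemma eventually_left_right_line:
  "\<forall>\<^sub>F t in at_right 0. {i. x i \<le> fst (q + t *\<^sub>R d)} =
     (if 0 \<le> fst d then {i. x i \<le> fst q} else {i. x i < fst q})"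
proof (cases "fst d = 0")
  case True
  then show ?thesis by simp
next
  case False
  have "filterlim (\<lambda>t. fst q + t * fst d) (at (fst q)) (at_right 0)"
    unfolding filterlim_at
    using False by (auto intro!: tendsto_eq_intros simp: eventually_at_filter)
  from eventually_compose_filterlim[OF eventually_left_right_sets this]
  have "\<forall>\<^sub>F t in at_right 0. {i. x i \<le> fst (q + t *\<^sub>R d)} =
      (if fst q \<le> fst q + t * fst d then {i. x i \<le> fst q} else {i. x i < fst q})"
    by simp
  moreover have "\<forall>\<^sub>F t in at_right 0. (0::real) < t" by (rule eventually_at_right_less)
  ultimately show ?thesis
    by eventually_elim (simp add: zero_le_mult_iff)
qed

text \<open>The same cut represents \<open>airy\<close> on short rays in all directions from a
  non-vertex, so second differences can be taken edge by edge.\<close>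

lemma eventually_airy_line:
  assumes nv: "\<And>k. (x k, y k) \<noteq> q"
  shows "\<forall>\<^sub>F t in at_right 0. airy (q + t *\<^sub>R d) = cut {i. x i \<le> fst q} (q + t *\<^sub>R d)"
  using eventually_left_right_line[of q d] eventually_cut_swap[OF nv, of d]
  by eventually_elim (auto simp: airy_def)

text \<open>A cut edge contributes to the second difference only if its line passes through
  \<open>q\<close>. Off \<open>G\<close> the contribution is nonnegative because \<open>w\<close>
  is; the only edge of \<open>G\<close> through \<open>q\<close> is neutralized by moving along
  it.\<close>

lemma airy_midpoint_nonvertex:
  assumes nv: "\<And>k. (x k, y k) \<noteq> q"
    and nonneg: "\<And>i j. i \<noteq> j \<Longrightarrow> \<not> G i j \<Longrightarrow> 0 \<le> w i j"
    and noncrossing: "\<And>i j k l. G i j \<Longrightarrow> G k l \<Longrightarrow> x i \<le> fst q \<Longrightarrow> fst q < x j \<Longrightarrow>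
      x k \<le> fst q \<Longrightarrow> fst q < x l \<Longrightarrow> dd i j q = 0 \<Longrightarrow> dd k l q = 0 \<Longrightarrow> i = k \<and> j = l"
  shows "\<exists>d. d \<noteq> 0 \<and> 2 * airy q \<le> airy (q + d) + airy (q - d)"
proof -
  let ?A = "{i. x i \<le> fst q}"
  \<comment> \<open>\<open>d\<close> is the direction of the edge of \<open>G\<close> through
    \<open>q\<close>; if there is none, any nonzero vector will do.\<close>
  obtain d where d: "d \<noteq> 0"
    and along: "\<And>i j. i \<in> ?A \<Longrightarrow> j \<in> - ?A \<Longrightarrow> G i j \<Longrightarrow> dd i j q = 0 \<Longrightarrow>
       snd d * (x j - x i) - fst d * (y j - y i) = 0"
  proof (cases "\<exists>i j. i \<in> ?A \<and> j \<in> - ?A \<and> G i j \<and> dd i j q = 0")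
    case True
    then obtain i j where ij: "i \<in> ?A" "j \<in> - ?A" "G i j" "dd i j q = 0" by blast
    show thesis
    proof (rule that[of "(x j - x i, y j - y i)"])
      show "(x j - x i, y j - y i) \<noteq> 0" using ij by (auto simp: prod_eq_iff)
    next
      fix k l assume kl: "k \<in> ?A" "l \<in> - ?A" "G k l" "dd k l q = 0"
      have "i = k \<and> j = l" using noncrossing[of i j k l] ij kl by auto
      then show "snd (x j - x i, y j - y i) * (x l - x k) - fst (x j - x i, y j - y i) * (y l - y k) = 0"
        by simp
    qed
  next
    case False
    then show thesis by (intro that[of "(1,0)"]) (auto simp: zero_prod_def)
  qed
  let ?m = "\<lambda>i j. snd d * (x j - x i) - fst d * (y j - y i)"
  have "\<forall>\<^sub>F t in at_right 0. \<forall>i\<in>?A. \<forall>j\<in>-?A.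
      2 * (w i j * \<bar>dd i j q\<bar>) \<le> w i j * \<bar>dd i j (q + t *\<^sub>R d)\<bar> + w i j * \<bar>dd i j (q - t *\<^sub>R d)\<bar>"
  proof (intro eventually_ball_finite ballI)
    fix i j assume ij: "i \<in> ?A" "j \<in> -?A"
    show "\<forall>\<^sub>F t in at_right 0.
      2 * (w i j * \<bar>dd i j q\<bar>) \<le> w i j * \<bar>dd i j (q + t *\<^sub>R d)\<bar> + w i j * \<bar>dd i j (q - t *\<^sub>R d)\<bar>"
    proof (cases "dd i j q = 0")
      case False
      from eventually_abs_second_difference[OF this, of "?m i j"] show ?thesis
        by eventually_elim (simp add: dd_line dd_line_minus flip: distrib_left)
    next
      case True
      show ?thesis
      proof (cases "G i j")
        case g: True
        show ?thesis using along[OF ij g True] True by (simp add: dd_line dd_line_minus)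
      next
        case False
        then have "0 \<le> w i j" using nonneg[of i j] ij by auto
        then show ?thesis using True by simp
      qed
    qed
  qed auto
  moreover have "\<forall>\<^sub>F t in at_right 0. airy (q + t *\<^sub>R d) = cut ?A (q + t *\<^sub>R d)"
    by (rule eventually_airy_line[OF nv])
  moreover have "\<forall>\<^sub>F t in at_right 0. airy (q - t *\<^sub>R d) = cut ?A (q - t *\<^sub>R d)"
    using eventually_airy_line[OF nv, of "-d"] by simp
  moreover have "\<forall>\<^sub>F t in at_right 0. (0::real) < t" by (rule eventually_at_right_less)
  ultimately have "\<forall>\<^sub>F t in at_right 0. t *\<^sub>R d \<noteq> 0 \<and> 2 * airy q \<le> airy (q + t *\<^sub>R d) + airy (q - t *\<^sub>R d)"
  proof eventually_elim
    case (elim t)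
    have "2 * airy q = (\<Sum>i\<in>?A. \<Sum>j\<in>-?A. 2 * (w i j * \<bar>dd i j q\<bar>))"
      by (simp add: airy_def cut_def sum_distrib_left)
    also have "\<dots> \<le> (\<Sum>i\<in>?A. \<Sum>j\<in>-?A. w i j * \<bar>dd i j (q + t *\<^sub>R d)\<bar> + w i j * \<bar>dd i j (q - t *\<^sub>R d)\<bar>)"
      using elim(1) by (intro sum_mono) blast
    also have "\<dots> = airy (q + t *\<^sub>R d) + airy (q - t *\<^sub>R d)"
      by (simp add: elim cut_def sum.distrib)
    finally show ?case using elim(4) d by simp
  qed
  then show ?thesis
    using eventually_happens'[OF trivial_limit_at_right_real] by blast
qed

text \<open>By general position the line of an edge avoiding \<open>k\<close> misses vertex
  \<open>k\<close>, so only edges at \<open>k\<close> contribute. Since \<open>d\<close> points to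
  the right, edges from \<open>k\<close> to the right are cut at \<open>+ t\<close> and those to the
  left at \<open>- t\<close>: each counts once.\<close>

lemma airy_second_difference_vertex:
  assumes d: "fst d > 0"
  shows "\<forall>\<^sub>F t in at_right 0. airy ((x k, y k) + t *\<^sub>R d) + airy ((x k, y k) - t *\<^sub>R d)
     = 2 * airy (x k, y k) + t * (\<Sum>j\<in>UNIV. w k j * \<bar>snd d * (x j - x k) - fst d * (y j - y k)\<bar>)"
proof -
  let ?q = "(x k, y k)" and ?A = "{i. x i < x k}" and ?B = "- insert k {i. x i < x k}"
  let ?m = "\<lambda>i j. snd d * (x j - x i) - fst d * (y j - y i)"
  \<comment> \<open>\<open>?c\<close> collects the cut edges that avoid \<open>k\<close>; they are
    common to the cuts on both sides of the vertical line through \<open>k\<close>.\<close>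
  let ?c = "\<lambda>q. \<Sum>i\<in>?A. \<Sum>j\<in>?B. w i j * \<bar>dd i j q\<bar>"
  have kk: "dd k j ?q = 0" for j by (simp add: dd_def)
  have AB: "- ?A = insert k ?B" by auto
  have cutA: "cut ?A q = ?c q + (\<Sum>i\<in>?A. w k i * \<bar>dd k i q\<bar>)" for q
  proof -
    have "(\<Sum>i\<in>?A. w i k * \<bar>dd i k q\<bar>) = (\<Sum>i\<in>?A. w k i * \<bar>dd k i q\<bar>)"
      by (intro sum.cong refl, subst w_sym, subst abs_dd_sym) simp
    moreover have "(\<Sum>j\<in>insert k ?B. w i j * \<bar>dd i j q\<bar>) = w i k * \<bar>dd i k q\<bar> + (\<Sum>j\<in>?B. w i j * \<bar>dd i j q\<bar>)" for i
      by (subst sum.insert) auto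
    ultimately show ?thesis unfolding cut_def AB by (simp add: sum.distrib)
  qed
  have cutB: "cut (insert k ?A) q = ?c q + (\<Sum>j\<in>?B. w k j * \<bar>dd k j q\<bar>)" for q
    using cut_insert[of k ?A q] cutA[of q] by simp
  have le: "{i. x i \<le> x k} = insert k ?A" by (rule le_eq_insert_less) simp
  have "\<forall>\<^sub>F t in at_right 0. \<forall>i\<in>?A. \<forall>j\<in>?B.
      \<bar>dd i j (?q + t *\<^sub>R d)\<bar> + \<bar>dd i j (?q - t *\<^sub>R d)\<bar> = 2 * \<bar>dd i j ?q\<bar>"
  proof (intro eventually_ball_finite ballI)
    fix i j assume ij: "i \<in> ?A" "j \<in> ?B"
    then have "dd i j ?q \<noteq> 0"
      using not_collinear[of k i j] by (auto simp: dd_def)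
    from eventually_abs_second_difference[OF this, of "?m i j"]
    show "\<forall>\<^sub>F t in at_right 0. \<bar>dd i j (?q + t *\<^sub>R d)\<bar> + \<bar>dd i j (?q - t *\<^sub>R d)\<bar> = 2 * \<bar>dd i j ?q\<bar>"
      unfolding dd_line dd_line_minus .
  qed auto
  moreover have "\<forall>\<^sub>F t in at_right 0. airy (?q + t *\<^sub>R d) = cut (insert k ?A) (?q + t *\<^sub>R d)"
    using eventually_left_right_line[of ?q d] by eventually_elim (use d le in \<open>simp add: airy_def\<close>)
  moreover have "\<forall>\<^sub>F t in at_right 0. airy (?q - t *\<^sub>R d) = cut ?A (?q - t *\<^sub>R d)"
    using eventually_left_right_line[of ?q "-d"] by eventually_elim (use d in \<open>simp add: airy_def\<close>)
  moreover have "\<forall>\<^sub>F t in at_right 0. (0::real) < t" by (rule eventually_at_right_less)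
  ultimately show ?thesis
  proof eventually_elim
    case (elim t)
    have "?c (?q + t *\<^sub>R d) + ?c (?q - t *\<^sub>R d)
        = (\<Sum>i\<in>?A. \<Sum>j\<in>?B. w i j * (\<bar>dd i j (?q + t *\<^sub>R d)\<bar> + \<bar>dd i j (?q - t *\<^sub>R d)\<bar>))"
      by (simp add: sum.distrib distrib_left)
    also have "\<dots> = (\<Sum>i\<in>?A. \<Sum>j\<in>?B. w i j * (2 * \<bar>dd i j ?q\<bar>))"
      using elim(1) by (intro sum.cong refl) simp
    also have "\<dots> = 2 * ?c ?q"
      by (simp add: sum_distrib_left mult.left_commute)
    also have "\<dots> = 2 * airy ?q"
      using cutB[of ?q] by (simp add: airy_def le kk)
    finally have 1: "?c (?q + t *\<^sub>R d) + ?c (?q - t *\<^sub>R d) = 2 * airy ?q" .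
    have "\<bar>dd k j (?q + t *\<^sub>R d)\<bar> = t * \<bar>?m k j\<bar>" "\<bar>dd k j (?q - t *\<^sub>R d)\<bar> = t * \<bar>?m k j\<bar>" for j
      unfolding dd_line dd_line_minus kk using elim(4) by (simp_all add: abs_mult)
    then have "airy (?q + t *\<^sub>R d) + airy (?q - t *\<^sub>R d)
       = 2 * airy ?q + ((\<Sum>j\<in>?B. t * (w k j * \<bar>?m k j\<bar>)) + (\<Sum>j\<in>?A. t * (w k j * \<bar>?m k j\<bar>)))"
      unfolding elim cutA cutB 1[symmetric] by (simp add: mult.left_commute)
    also have "(\<Sum>j\<in>?B. t * (w k j * \<bar>?m k j\<bar>)) + (\<Sum>j\<in>?A. t * (w k j * \<bar>?m k j\<bar>))
       = (\<Sum>j\<in>?B \<union> ?A. t * (w k j * \<bar>?m k j\<bar>))"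
      by (intro sum.union_disjoint[symmetric]) auto
    also have "\<dots> = (\<Sum>j\<in>UNIV. t * (w k j * \<bar>?m k j\<bar>))"
      by (intro sum.mono_neutral_left) auto
    finally show ?case by (simp add: sum_distrib_left)
  qed
qed

text \<open>Equilibrium at \<open>k\<close> permits subtracting \<open>s\<close> times the signed
  sum, which is zero. Then the neighbours in \<open>G\<close>, all on one side, contribute nothing,
  and every other term is nonnegative.\<close>

lemma airy_midpoint_vertex:
  assumes d: "fst d > 0"
    and nonneg: "\<And>j. j \<noteq> k \<Longrightarrow> \<not> G k j \<Longrightarrow> 0 \<le> w k j"
    and side: "\<And>j. G k j \<Longrightarrow> s * (snd d * (x j - x k) - fst d * (y j - y k)) > 0"
    and s: "\<bar>s\<bar> = 1"
  shows "\<exists>d. d \<noteq> 0 \<and> 2 * airy (x k, y k) \<le> airy ((x k, y k) + d) + airy ((x k, y k) - d)"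
proof -
  let ?m = "\<lambda>j. snd d * (x j - x k) - fst d * (y j - y k)"
  have "(\<Sum>j\<in>UNIV. w k j * ?m j) = snd d * (\<Sum>j\<in>UNIV. w k j * (x j - x k)) - fst d * (\<Sum>j\<in>UNIV. w k j * (y j - y k))"
    unfolding sum_distrib_left sum_subtractf[symmetric] by (intro sum.cong refl) (simp add: algebra_simps)
  then have "(\<Sum>j\<in>UNIV. w k j * ?m j) = 0" by (simp add: equilibrium_x equilibrium_y)
  then have "(\<Sum>j\<in>UNIV. w k j * \<bar>?m j\<bar>) = (\<Sum>j\<in>UNIV. w k j * \<bar>?m j\<bar>) - s * (\<Sum>j\<in>UNIV. w k j * ?m j)"
    by simp
  also have "\<dots> = (\<Sum>j\<in>UNIV. w k j * (\<bar>?m j\<bar> - s * ?m j))"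
    unfolding sum_distrib_left sum_subtractf[symmetric] by (intro sum.cong refl) (simp only: algebra_simps)
  also have "\<dots> \<ge> 0"
  proof (rule sum_nonneg)
    fix j
    have abs: "\<bar>s * ?m j\<bar> = \<bar>?m j\<bar>" using s by (simp add: abs_mult)
    show "0 \<le> w k j * (\<bar>?m j\<bar> - s * ?m j)"
    proof (cases "G k j")
      case True
      then have "\<bar>?m j\<bar> = s * ?m j" using side[OF True] abs by simp
      then show ?thesis by simp
    next
      case False
      have "0 \<le> \<bar>?m j\<bar> - s * ?m j" using abs by linarith
      then show ?thesis using nonneg[of j] False by (cases "j = k") auto
    qed
  qed
  finally have nn: "0 \<le> (\<Sum>j\<in>UNIV. w k j * \<bar>?m j\<bar>)" .
  have "\<forall>\<^sub>F t in at_right 0. (0::real) < t" by (rule eventually_at_right_less)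
  moreover note airy_second_difference_vertex[OF d, of k]
  ultimately have "\<forall>\<^sub>F t in at_right 0. t *\<^sub>R d \<noteq> 0 \<and>
      2 * airy (x k, y k) \<le> airy ((x k, y k) + t *\<^sub>R d) + airy ((x k, y k) - t *\<^sub>R d)"
  proof eventually_elim
    case (elim t)
    have "t *\<^sub>R d \<noteq> 0" using elim d by auto
    moreover have "0 \<le> t * (\<Sum>j\<in>UNIV. w k j * \<bar>?m j\<bar>)" using elim nn by simp
    ultimately show ?case using elim by linarith
  qed
  then show ?thesis
    using eventually_happens'[OF trivial_limit_at_right_real] by blast
qed

text \<open>The second differences at vertex \<open>k\<close> give a function of the direction that
  is identically zero, while its term for \<open>l\<close> has a kink proportional to
  \<open>w k l\<close> at the direction of \<open>l\<close>. A second difference in the slope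
  isolates this kink.\<close>

lemma airy_zero_imp_stress_zero:
  assumes zero: "\<And>q. airy q = 0" and "i \<noteq> j"
  shows "w i j = 0"
proof -
  have *: "w k l = 0" if lt: "x k < x l" for k l
  proof -
    let ?F = "\<lambda>d. \<Sum>j\<in>UNIV. w k j * \<bar>snd d * (x j - x k) - fst d * (y j - y k)\<bar>"
    have F0: "?F d = 0" if "fst d > 0" for d
    proof -
      have "\<forall>\<^sub>F t in at_right 0. (0::real) < t" by (rule eventually_at_right_less)
      with airy_second_difference_vertex[OF that, of k]
      have "\<forall>\<^sub>F t in at_right (0::real). ?F d = 0"
        by eventually_elim (simp add: zero)
      then show ?thesis by simp
    qed
    let ?r = "\<lambda>j. (y l - y k) * (x j - x k) - (x l - x k) * (y j - y k)"
    have r: "?r j \<noteq> 0" if "j \<in> - {k,l}" for j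
      using not_collinear[of k j l] that lt by (auto simp: mult.commute)
    have "\<forall>\<^sub>F t in at_right 0. \<forall>j\<in>-{k,l}. \<bar>?r j + t * (x j - x k)\<bar> + \<bar>?r j - t * (x j - x k)\<bar> = 2 * \<bar>?r j\<bar>"
      by (intro eventually_ball_finite ballI eventually_abs_second_difference r) auto
    moreover have "\<forall>\<^sub>F t in at_right 0. (0::real) < t" by (rule eventually_at_right_less)
    ultimately have "\<forall>\<^sub>F t in at_right (0::real). w k l = 0"
    proof eventually_elim
      case (elim t)
      let ?s = "\<lambda>j. \<bar>?r j + t * (x j - x k)\<bar> + \<bar>?r j - t * (x j - x k)\<bar> - 2 * \<bar>?r j\<bar>"
      \<comment> \<open>The middle direction leads from \<open>k\<close> to \<open>l\<close>, where
        the term for \<open>l\<close> vanishes; it points to the right because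
        \<open>x k < x l\<close>.\<close>
      have "0 = ?F (x l - x k, y l - y k + t) + ?F (x l - x k, y l - y k - t) - 2 * ?F (x l - x k, y l - y k)"
        using lt by (subst (1 2 3) F0) auto
      also have "\<dots> = (\<Sum>j\<in>UNIV. w k j * ?s j)"
        unfolding sum_distrib_left sum.distrib[symmetric] sum_subtractf[symmetric]
        by (intro sum.cong refl) (simp add: algebra_simps)
      also have "\<dots> = (\<Sum>j\<in>{l}. w k j * ?s j)"
        using elim(1) by (intro sum.mono_neutral_right) auto
      also have "\<dots> = w k l * (2 * (t * (x l - x k)))"
        using elim(2) lt by (simp add: abs_mult)
      finally show ?case using elim(2) lt by simp
    qed
    then show ?thesis by simp
  qed
  have "x i \<noteq> x j" using inj_x \<open>i \<noteq> j\<close> by (auto simp: inj_def)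
  then show ?thesis
    using *[of i j] *[of j i] w_sym[of i j] by linarith
qed

end

section \<open>The integral of the Airy function\<close>

lemma has_integral_abs_shift:
  fixes L R :: real
  assumes "\<bar>L\<bar> \<le> R"
  shows "((\<lambda>t. \<bar>t - L\<bar>) has_integral (R\<^sup>2 + L\<^sup>2)) {-R..R}"
proof -
  have 1: "((\<lambda>t. L - t) has_integral (- (L - L)\<^sup>2 / 2 - (- (L - (- R))\<^sup>2 / 2))) {-R..L}"
    using assms by (intro fundamental_theorem_of_calculus)
      (auto intro!: derivative_eq_intros simp: field_simps has_real_derivative_iff_has_vector_derivative[symmetric])
  have "((\<lambda>t. \<bar>t - L\<bar>) has_integral ((L + R)\<^sup>2 / 2)) {-R..L}"
    by (rule has_integral_eq[OF _ 1[simplified]]) auto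
  moreover
  have 2: "((\<lambda>t. t - L) has_integral ((R - L)\<^sup>2 / 2 - (L - L)\<^sup>2 / 2)) {L..R}"
    using assms by (intro fundamental_theorem_of_calculus)
      (auto intro!: derivative_eq_intros simp: has_real_derivative_iff_has_vector_derivative[symmetric])
  have "((\<lambda>t. \<bar>t - L\<bar>) has_integral ((R - L)\<^sup>2 / 2)) {L..R}"
    by (rule has_integral_eq[OF _ 2[simplified]]) auto
  ultimately have "((\<lambda>t. \<bar>t - L\<bar>) has_integral ((L + R)\<^sup>2 / 2 + (R - L)\<^sup>2 / 2)) {-R..R}"
    using assms by (intro has_integral_combine[of "-R" L R]) auto
  moreover have "(L + R)\<^sup>2 / 2 + (R - L)\<^sup>2 / 2 = R\<^sup>2 + L\<^sup>2"
    by (simp add: power2_eq_square field_simps)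
  ultimately show ?thesis by (simp only:)
qed

context planar_stress
begin

definition height :: "'n \<Rightarrow> 'n \<Rightarrow> real \<Rightarrow> real" where
  "height i j c = y i + (y j - y i) / (x j - x i) * (c - x i)"

lemma dd_height:
  assumes "x i < x j"
  shows "dd i j (c, t) = (x j - x i) * (t - height i j c)"
  using assms by (simp add: dd_def height_def field_simps)

lemma abs_height_le:
  assumes "x i < x j" "x i \<le> c" "c \<le> x j" "\<bar>y i\<bar> \<le> R" "\<bar>y j\<bar> \<le> R"
  shows "\<bar>height i j c\<bar> \<le> R"
proof -
  define s where "s = (c - x i) / (x j - x i)"
  have s: "0 \<le> s" "s \<le> 1" using assms by (auto simp: s_def)
  have h: "height i j c = (1 - s) * y i + s * y j"
    by (simp add: height_def s_def algebra_simps diff_divide_distrib add_divide_distrib)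
  have "\<bar>height i j c\<bar> \<le> (1 - s) * \<bar>y i\<bar> + s * \<bar>y j\<bar>"
    unfolding h using s by (intro order_trans[OF abs_triangle_ineq]) (simp add: abs_mult)
  also have "\<dots> \<le> (1 - s) * R + s * R"
    using s assms by (intro add_mono mult_left_mono) auto
  finally show ?thesis by (simp add: algebra_simps)
qed

text \<open>The integral of \<open>airy\<close> along the vertical line at \<open>c\<close>: an edge
  crossing it at height \<open>h\<close> contributes the integral of the distance to
  \<open>h\<close> over \<open>{-R..R}\<close>, which is \<open>R^2 + h^2\<close>, times its
  horizontal extent.\<close>

definition slice :: "real \<Rightarrow> real \<Rightarrow> real" where
  "slice R c = (\<Sum>i\<in>UNIV. \<Sum>j\<in>UNIV. w i j *
     (if x i \<le> c \<and> c < x j then (x j - x i) * (R\<^sup>2 + (height i j c)\<^sup>2) else 0))"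

lemma has_integral_slice:
  assumes R: "\<And>i. \<bar>y i\<bar> \<le> R"
  shows "((\<lambda>t. airy (c, t)) has_integral slice R c) {-R..R}"
proof -
  have "((\<lambda>t. w i j * (if x i \<le> c \<and> c < x j then \<bar>dd i j (c, t)\<bar> else 0)) has_integral
      w i j * (if x i \<le> c \<and> c < x j then (x j - x i) * (R\<^sup>2 + (height i j c)\<^sup>2) else 0)) {-R..R}" for i j
  proof (cases "x i \<le> c \<and> c < x j")
    case True
    have "\<bar>height i j c\<bar> \<le> R" using True R by (intro abs_height_le) auto
    from has_integral_mult_right[OF has_integral_abs_shift[OF this], of "w i j * (x j - x i)"]
    show ?thesis using True by (simp add: dd_height abs_mult mult.assoc)
  next
    case False
    show ?thesis unfolding if_not_P[OF False] by simp
  qed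
  then have "((\<lambda>t. \<Sum>i\<in>UNIV. \<Sum>j\<in>UNIV. w i j * (if x i \<le> c \<and> c < x j then \<bar>dd i j (c, t)\<bar> else 0))
      has_integral slice R c) {-R..R}"
    unfolding slice_def by (intro has_integral_sum) auto
  moreover have "(\<Sum>i\<in>UNIV. \<Sum>j\<in>UNIV. w i j * (if x i \<le> c \<and> c < x j then \<bar>dd i j (c, t)\<bar> else 0))
      = airy (c, t)" for t
  proof -
    have "airy (c, t) = (\<Sum>i\<in>{i. x i \<le> c}. \<Sum>j\<in>UNIV. w i j * (if x i \<le> c \<and> c < x j then \<bar>dd i j (c, t)\<bar> else 0))"
      unfolding airy_def cut_def fst_conv
      by (intro sum.cong refl sum.mono_neutral_cong_left) (auto simp: not_le)
    also have "\<dots> = (\<Sum>i\<in>UNIV. \<Sum>j\<in>UNIV. w i j * (if x i \<le> c \<and> c < x j then \<bar>dd i j (c, t)\<bar> else 0))"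
      by (intro sum.mono_neutral_left) auto
    finally show ?thesis by simp
  qed
  ultimately show ?thesis by simp
qed

lemma has_integral_height:
  assumes lt: "x i < x j" and R: "\<And>i. \<bar>x i\<bar> \<le> R"
  shows "((\<lambda>c. if x i \<le> c \<and> c < x j then (x j - x i) * (R\<^sup>2 + (height i j c)\<^sup>2) else 0) has_integral
     (x i - x j)\<^sup>2 * (R\<^sup>2 + ((y i)\<^sup>2 + y i * y j + (y j)\<^sup>2) / 3)) {-R..R}"
proof -
  define D s where "D = x j - x i" and "s = (y j - y i) / (x j - x i)"
  have yj: "y j = y i + s * D" and xj: "x j = x i + D" using lt by (simp_all add: s_def D_def)
  let ?P = "\<lambda>c. D * (R\<^sup>2 * c + (y i)\<^sup>2 * c + y i * s * (c - x i)\<^sup>2 + s\<^sup>2 * (c - x i) ^ 3 / 3)"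
  have "(?P has_real_derivative D * (R\<^sup>2 + (y i + s * (c - x i))\<^sup>2)) (at c within {x i..x j})" for c
    by (rule derivative_eq_intros refl | simp)+ (simp add: power2_eq_square field_simps)
  then have "((\<lambda>c. D * (R\<^sup>2 + (height i j c)\<^sup>2)) has_integral (?P (x j) - ?P (x i))) {x i..x j}"
    using lt unfolding height_def s_def[symmetric]
    by (intro fundamental_theorem_of_calculus)
      (auto simp: has_real_derivative_iff_has_vector_derivative[symmetric])
  moreover have "?P (x j) - ?P (x i) = (x i - x j)\<^sup>2 * (R\<^sup>2 + ((y i)\<^sup>2 + y i * y j + (y j)\<^sup>2) / 3)"
    unfolding yj xj by (simp add: power2_eq_square power3_eq_cube field_simps)
  ultimately have "((\<lambda>c. D * (R\<^sup>2 + (height i j c)\<^sup>2)) has_integral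
      (x i - x j)\<^sup>2 * (R\<^sup>2 + ((y i)\<^sup>2 + y i * y j + (y j)\<^sup>2) / 3)) {x i..x j}"
    by simp
  then have "((\<lambda>c. if c \<in> {x i..x j} then D * (R\<^sup>2 + (height i j c)\<^sup>2) else 0) has_integral
      (x i - x j)\<^sup>2 * (R\<^sup>2 + ((y i)\<^sup>2 + y i * y j + (y j)\<^sup>2) / 3)) {-R..R}"
    using R[of i] R[of j] by (subst has_integral_restrict) auto
  then show ?thesis
    unfolding D_def by (rule has_integral_spike_finite[of "{x j}", rotated 2]) auto
qed

text \<open>The double integral of \<open>airy\<close> is a sixth of the energy, whatever
  \<open>a\<close> and \<open>b\<close> are. Each edge is integrated once, in \<open>T\<close>; the
  symmetric \<open>S\<close> counts it twice, and \<open>3 * S\<close> has the same total as the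
  energy terms.\<close>

lemma has_integral_slice_energy:
  assumes R: "\<And>i. \<bar>x i\<bar> \<le> R"
  shows "(slice R has_integral (\<Sum>i\<in>UNIV. \<Sum>j\<in>UNIV. w i j * (dd i j a * dd i j b)) / 6) {-R..R}"
proof -
  define S where "S i j = w i j * ((x i - x j)\<^sup>2 * (R\<^sup>2 + ((y i)\<^sup>2 + y i * y j + (y j)\<^sup>2) / 3))" for i j
  define T where "T i j = (if x i < x j then S i j else 0)" for i j
  have S_sym: "S i j = S j i" for i j
    unfolding S_def by (subst w_sym) (simp add: power2_commute algebra_simps)
  have "S i j = T i j + T j i" for i j
    using S_sym[of i j] by (cases "x i" "x j" rule: linorder_cases) (auto simp: T_def S_def)
  then have "(\<Sum>i\<in>UNIV. \<Sum>j\<in>UNIV. S i j)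
     = (\<Sum>i\<in>UNIV. \<Sum>j\<in>UNIV. T i j) + (\<Sum>i\<in>UNIV. \<Sum>j\<in>UNIV. T j i)"
    by (simp add: sum.distrib)
  also have "(\<Sum>i\<in>UNIV. \<Sum>j\<in>UNIV. T j i) = (\<Sum>i\<in>UNIV. \<Sum>j\<in>UNIV. T i j)"
    by (rule sum.swap)
  finally have ST: "(\<Sum>i\<in>UNIV. \<Sum>j\<in>UNIV. T i j) = (\<Sum>i\<in>UNIV. \<Sum>j\<in>UNIV. S i j) / 2"
    by simp
  \<comment> \<open>The two sides differ by the strain of the velocity field \<open>(u, v)\<close>, whose pairing with
    every self-stress is zero.\<close>
  define u where "u i = 3 * R\<^sup>2 * x i + 2 * x i * (y i)\<^sup>2 + (snd a + snd b) * x i * y i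
     - (fst a + fst b) * (y i)\<^sup>2 - snd a * snd b * x i + (fst a * snd b + snd a * fst b) * y i" for i
  define v where "v i = - (x i)\<^sup>2 * y i - (snd a + snd b) * (x i)\<^sup>2
     + (fst a + fst b) * x i * y i - fst a * fst b * y i" for i
  have S1: "3 * ((x i - x j)\<^sup>2 * (R\<^sup>2 + ((y i)\<^sup>2 + y i * y j + (y j)\<^sup>2) / 3))
      = dd i j a * dd i j b + (x i - x j) * (u i - u j) + (y i - y j) * (v i - v j)" for i j
    unfolding u_def v_def dd_def by (simp add: power2_eq_square field_simps)
  have S3: "3 * S i j = w i j * (dd i j a * dd i j b) + w i j * ((x i - x j) * (u i - u j))
      + w i j * ((y i - y j) * (v i - v j))" for i j
  proof -
    have "3 * S i j = w i j * (3 * ((x i - x j)\<^sup>2 * (R\<^sup>2 + ((y i)\<^sup>2 + y i * y j + (y j)\<^sup>2) / 3)))"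
      by (simp only: S_def mult.left_commute)
    then show ?thesis unfolding S1 by (simp only: distrib_left)
  qed
  have "3 * (\<Sum>i\<in>UNIV. \<Sum>j\<in>UNIV. S i j) = (\<Sum>i\<in>UNIV. \<Sum>j\<in>UNIV. w i j * (dd i j a * dd i j b))"
    unfolding sum_distrib_left S3 sum.distrib
    using sum_stress_zero[of x u, OF equilibrium_x] sum_stress_zero[of y v, OF equilibrium_y] by simp
  then have total: "(\<Sum>i\<in>UNIV. \<Sum>j\<in>UNIV. T i j) = (\<Sum>i\<in>UNIV. \<Sum>j\<in>UNIV. w i j * (dd i j a * dd i j b)) / 6"
    using ST by simp
  have "((\<lambda>c. w i j * (if x i \<le> c \<and> c < x j then (x j - x i) * (R\<^sup>2 + (height i j c)\<^sup>2) else 0))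
      has_integral T i j) {-R..R}" for i j
  proof (cases "x i < x j")
    case True
    show ?thesis unfolding T_def S_def
      using True has_integral_mult_right[OF has_integral_height[OF True R], of "w i j"] by simp
  next
    case False
    then have "(x i \<le> c \<and> c < x j) = False" for c by auto
    then show ?thesis using False by (simp only: T_def if_False mult_zero_right has_integral_0)
  qed
  then have "(slice R has_integral (\<Sum>i\<in>UNIV. \<Sum>j\<in>UNIV. T i j)) {-R..R}"
    unfolding slice_def[abs_def] by (intro has_integral_sum) auto
  then show ?thesis by (simp only: total)
qed

text \<open>A negative value of \<open>airy\<close> would persist on a square and make the double
  integral negative, against the nonnegative energy. So \<open>airy\<close> vanishes, and with it
  the stress.\<close>

lemma stress_zero_if_airy_nonpos:
  assumes nonpos: "\<And>q. airy q \<le> 0"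
    and energy: "0 \<le> (\<Sum>i\<in>UNIV. \<Sum>j\<in>UNIV. w i j * (dd i j a * dd i j b))"
    and "i \<noteq> j"
  shows "w i j = 0"
proof (rule airy_zero_imp_stress_zero[OF _ \<open>i \<noteq> j\<close>], rule ccontr)
  fix q0 assume "airy q0 \<noteq> 0"
  then have neg: "airy q0 < 0" using nonpos[of q0] by simp
  obtain R where R: "\<And>i. \<bar>x i\<bar> < R" "\<And>i. \<bar>y i\<bar> < R"
    "\<And>q. R \<le> \<bar>fst q\<bar> \<or> R \<le> \<bar>snd q\<bar> \<Longrightarrow> airy q = 0"
    using airy_support by blast
  define m where "m = - airy q0 / 2"
  have m: "m > 0" using neg by (simp add: m_def)
  obtain e where e: "e > 0" "\<And>q. dist q q0 < e \<Longrightarrow> dist (airy q) (airy q0) < m"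
    using isCont_airy[of q0] m unfolding continuous_at_eps_delta by blast
  \<comment> \<open>Points of the square with half-side \<open>\<delta>\<close> are within
    \<open>2 * \<delta> < e\<close> of \<open>q0\<close>.\<close>
  define \<delta> where "\<delta> = e / 4"
  have \<delta>: "\<delta> > 0" using e by (simp add: \<delta>_def)
  have near: "airy (c, t) < - m"
    if "c \<in> {fst q0 - \<delta>..fst q0 + \<delta>}" "t \<in> {snd q0 - \<delta>..snd q0 + \<delta>}" for c t
  proof -
    have "dist (c, t) q0 \<le> \<bar>c - fst q0\<bar> + \<bar>t - snd q0\<bar>"
      by (cases q0) (simp add: dist_prod_def dist_real_def sqrt_sum_squares_le_sum_abs)
    also have "\<dots> \<le> \<delta> + \<delta>" using that by (intro add_mono) (auto simp: abs_le_iff)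
    also have "\<dots> < e" using \<delta> by (simp add: \<delta>_def)
    finally have "dist (airy (c, t)) (airy q0) < m" by (rule e(2))
    then show ?thesis by (auto simp: dist_real_def m_def)
  qed
  let ?C = "{fst q0 - \<delta>..fst q0 + \<delta>}" and ?T = "{snd q0 - \<delta>..snd q0 + \<delta>}"
  \<comment> \<open>The square lies in the box of integration because \<open>airy\<close> vanishes
    wherever a coordinate reaches \<open>R\<close> in absolute value.\<close>
  have sub: "?C \<subseteq> {-R..R}" "?T \<subseteq> {-R..R}"
  proof -
    show "?C \<subseteq> {-R..R}"
    proof
      fix c assume "c \<in> ?C"
      then have "airy (c, snd q0) \<noteq> 0" using near[of c "snd q0"] m \<delta> by force
      then show "c \<in> {-R..R}" using R(3)[of "(c, snd q0)"] by fastforce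
    qed
    show "?T \<subseteq> {-R..R}"
    proof
      fix t assume "t \<in> ?T"
      then have "airy (fst q0, t) \<noteq> 0" using near[of "fst q0" t] m \<delta> by force
      then show "t \<in> {-R..R}" using R(3)[of "(fst q0, t)"] by fastforce
    qed
  qed
  have step: "((\<lambda>t. if t \<in> {r - \<delta>..r + \<delta>} then - k else 0) has_integral (- k * (2 * \<delta>))) {-R..R}"
    if "{r - \<delta>..r + \<delta>} \<subseteq> {-R..R}" for r k
    using has_integral_const_real[of "- k" "r - \<delta>" "r + \<delta>"] \<delta> that
    by (subst has_integral_restrict) (auto simp: mult.commute)
  have sl: "((\<lambda>t. airy (c, t)) has_integral slice R c) {-R..R}" for c
    using R(2) by (intro has_integral_slice) (simp add: order_less_imp_le)
  have "slice R c \<le> (if c \<in> ?C then - (m * (2 * \<delta>)) else 0)" for c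
  proof (cases "c \<in> ?C")
    case True
    have "slice R c \<le> - m * (2 * \<delta>)"
    proof (rule has_integral_le[OF sl step[OF sub(2)]])
      fix t
      show "airy (c, t) \<le> (if t \<in> ?T then - m else 0)"
        using near[OF True, of t] nonpos[of "(c, t)"] by (cases "t \<in> ?T") auto
    qed
    then show ?thesis using True by simp
  next
    case False
    have "slice R c \<le> 0"
      by (rule has_integral_le[OF sl has_integral_0]) (rule nonpos)
    then show ?thesis unfolding if_not_P[OF False] .
  qed
  then have "(\<Sum>i\<in>UNIV. \<Sum>j\<in>UNIV. w i j * (dd i j a * dd i j b)) / 6 \<le> - (m * (2 * \<delta>)) * (2 * \<delta>)"
    using R(1) by (intro has_integral_le[OF has_integral_slice_energy step[OF sub(1)]])
      (auto simp: order_less_imp_le)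
  moreover have "m * (2 * \<delta>) * (2 * \<delta>) > 0" using m \<delta> by simp
  ultimately show False using energy by simp
qed

end

section \<open>Pointed vertices and half-planes\<close>

lemma det3_cross: "det3 a b c = Re (b - a) * Im (c - a) - Re (c - a) * Im (b - a)"
  by (simp add: det3_def algebra_simps)

lemma parallel_complex:
  assumes "u \<noteq> 0" "Re u * Im v = Re v * Im u"
  shows "v = (inner u v / inner u u) *\<^sub>R u"
proof -
  have n: "Re u * Re u + Im u * Im u \<noteq> 0"
    using assms(1) by (metis complex_neq_0 power2_eq_square less_irrefl)
  have "Re v * (Re u * Re u + Im u * Im u) = (Re u * Re v + Im u * Im v) * Re u"
    "Im v * (Re u * Re u + Im u * Im u) = (Re u * Re v + Im u * Im v) * Im u"
    using assms(2) by algebra+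
  with n show ?thesis
    by (intro complex_eqI) (simp_all add: inner_complex_def eq_divide_eq)
qed

lemma det3_zero_imp_collinear:
  assumes "det3 a b c = 0"
  shows "collinear {a, b, c}"
proof (cases "b = a")
  case False
  then have "c - a = (inner (b - a) (c - a) / inner (b - a) (b - a)) *\<^sub>R (b - a)"
    using assms by (intro parallel_complex) (auto simp: det3_cross)
  then have "collinear {0, b - a, c - a}" unfolding collinear_lemma by blast
  then show ?thesis
    using collinear_3[of b a c] by (simp add: insert_commute)
qed simp

lemma general_position_det3:
  assumes "general_position p" "i \<noteq> j" "j \<noteq> k" "i \<noteq> k"
  shows "det3 (p i) (p j) (p k) \<noteq> 0"
  using assms det3_zero_imp_collinear unfolding general_position_def by blast

lemma inner_complex_cis: "inner (cis \<phi>) (rcis r \<psi>) = r * cos (\<psi> - \<phi>)"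
  by (simp add: inner_complex_def rcis_def cos_diff algebra_simps)

lemma inner_mult_complex:
  fixes z :: complex
  shows "inner (z * c) (z * u) = (norm z)\<^sup>2 * inner c u"
  unfolding cmod_power2 by (simp add: inner_complex_def power2_eq_square algebra_simps)

text \<open>A gap larger than \<open>pi\<close> leaves all edges in a sector narrower than
  \<open>pi\<close>, whose bisector serves as \<open>d\<close>; a single edge provides its own
  direction.\<close>

lemma pointed_at_imp_halfplane:
  fixes p :: "'n::finite \<Rightarrow> complex"
  assumes gp: "general_position p" and pt: "pointed_at p G i"
  obtains d where "\<And>j. j \<in> neighbours G i \<Longrightarrow> inner d (p j - p i) > 0"
proof -
  have ne: "p j \<noteq> p i" if "j \<in> neighbours G i" for j
    using that gp by (auto simp: neighbours_def general_position_def inj_def)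
  from pt consider "card (neighbours G i) \<le> 1"
    | j k where "j \<in> neighbours G i" "k \<in> neighbours G i" "ccw_angle p i j k > pi"
      "\<And>l. l \<in> neighbours G i \<Longrightarrow> l \<noteq> j \<Longrightarrow> ccw_angle p i j k \<le> ccw_angle p i j l"
    unfolding pointed_at_def by (auto simp: not_less)
  then show thesis
  proof cases
    case 1
    show thesis
    proof (cases "neighbours G i = {}")
      case True
      then show thesis using that by blast
    next
      case False
      then have "card (neighbours G i) = 1" using 1 by (simp add: le_Suc_eq)
      then obtain j where "neighbours G i = {j}" by (auto simp: card_1_singleton_iff)
      then show thesis using ne by (intro that[of "p j - p i"]) auto
    qed
  next
    case (2 j k)
    define \<theta> where "\<theta> = ccw_angle p i j k"
    \<comment> \<open>Measured from \<open>j\<close>, the neighbours have angles between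
      \<open>\<theta>\<close> and \<open>2 * pi\<close>, with \<open>j\<close> itself placed at
      \<open>2 * pi\<close>; \<open>\<phi>\<close> is the middle of this range, which is shorter
      than \<open>pi\<close>.\<close>
    define \<phi> where "\<phi> = (\<theta> + 2 * pi) / 2"
    have \<theta>: "pi < \<theta>" "\<theta> < 2 * pi"
      using 2(3) Arg2pi_lt_2pi by (auto simp: \<theta>_def ccw_angle_def)
    show thesis
    proof
      fix l assume l: "l \<in> neighbours G i"
      let ?u = "(p l - p i) / (p j - p i)"
      have zj: "p j - p i \<noteq> 0" using ne[OF 2(1)] by simp
      have "?u \<noteq> 0" using ne[OF l] zj by simp
      have "cos (Arg2pi ?u - \<phi>) > 0"
      proof (cases "l = j")
        case True
        then have "Arg2pi ?u = 0" using zj by (simp add: Arg2pi_of_real[of 1, simplified])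
        then have "cos (Arg2pi ?u - \<phi>) = cos (2 * pi - \<phi>)" by simp
        also have "\<dots> > 0" using \<theta> by (intro cos_gt_zero_pi) (auto simp: \<phi>_def field_simps)
        finally show ?thesis .
      next
        case False
        then have "\<theta> \<le> Arg2pi ?u" using 2(4)[OF l] by (simp add: \<theta>_def ccw_angle_def)
        moreover have "Arg2pi ?u < 2 * pi" by (rule Arg2pi_lt_2pi)
        ultimately show ?thesis using \<theta> by (intro cos_gt_zero_pi) (auto simp: \<phi>_def field_simps)
      qed
      moreover have "?u = rcis (norm ?u) (Arg2pi ?u)"
        using Arg2pi_eq[of ?u] by (simp add: rcis_def cis_conv_exp)
      ultimately have "inner (cis \<phi>) ?u > 0"
        using inner_complex_cis[of \<phi> "norm ?u" "Arg2pi ?u"] \<open>?u \<noteq> 0\<close> by (metis mult_pos_pos zero_less_norm_iff)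
      then have "inner ((p j - p i) * cis \<phi>) ((p j - p i) * ?u) > 0"
        unfolding inner_mult_complex using zj by simp
      then show "inner ((p j - p i) * cis \<phi>) (p l - p i) > 0" using zj by simp
    qed
  qed
qed

text \<open>Measured from \<open>d\<close>, all edges have angles strictly between
  \<open>- pi / 2\<close> and \<open>pi / 2\<close>. Turning counterclockwise from the largest
  angle, at \<open>j\<close>, to the smallest, at \<open>k\<close>, sweeps the side without edges, a
  gap larger than \<open>pi\<close>.\<close>

lemma halfplane_imp_pointed_at:
  fixes p :: "'n::finite \<Rightarrow> complex"
  assumes gp: "general_position p"
    and d: "\<And>j. j \<in> neighbours G i \<Longrightarrow> inner d (p j - p i) > 0"
  shows "pointed_at p G i"
proof (cases "card (neighbours G i) \<le> 1")
  case True
  then show ?thesis by (simp add: pointed_at_def)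
next
  case False
  let ?N = "neighbours G i"
  have ne: "?N \<noteq> {}" using False by auto
  then have d0: "d \<noteq> 0" using d by fastforce
  define z where "z l = (p l - p i) / d" for l
  define ang where "ang l = Arg (z l)" for l
  have zd: "p l - p i = d * z l" for l using d0 by (simp add: z_def)
  have Rez: "Re (z l) > 0" if "l \<in> ?N" for l
  proof -
    have "0 < inner (d * 1) (d * z l)" using d[OF that] by (simp add: zd)
    then show ?thesis unfolding inner_mult_complex using d0
      by (simp add: inner_complex_def zero_less_mult_iff)
  qed
  have z0: "z l \<noteq> 0" if "l \<in> ?N" for l using Rez[OF that] by auto
  have ang: "\<bar>ang l\<bar> < pi / 2" if "l \<in> ?N" for l
    using Rez[OF that] z0[OF that] Arg_Re_pos[of "z l"] by (auto simp: ang_def)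
  have zang: "z l = of_real (norm (z l)) * exp (\<i> * of_real (ang l))" if "l \<in> ?N" for l
    using Arg_eq[OF z0[OF that]] by (simp add: ang_def)
  define j where "j = arg_min_on (\<lambda>l. - ang l) ?N"
  define k where "k = arg_min_on ang ?N"
  have j: "j \<in> ?N" "\<And>l. l \<in> ?N \<Longrightarrow> ang l \<le> ang j"
    using arg_min_if_finite[of ?N "\<lambda>l. - ang l"] ne by (auto simp: j_def not_less)
  have k: "k \<in> ?N" "\<And>l. l \<in> ?N \<Longrightarrow> ang k \<le> ang l"
    using arg_min_if_finite[of ?N ang] ne by (auto simp: k_def not_less)
  \<comment> \<open>Equal angles would put two neighbours on one ray from \<open>i\<close>.
    Distinctness keeps the angles counted from \<open>j\<close> strictly below
    \<open>2 * pi\<close>.\<close>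
  have distinct: "ang l \<noteq> ang m" if "l \<in> ?N" "m \<in> ?N" "l \<noteq> m" for l m
  proof
    assume eq: "ang l = ang m"
    have "z l = of_real (norm (z l) / norm (z m)) * z m"
      using zang[OF that(1)] zang[OF that(2)] z0[OF that(2)] unfolding eq
      by (metis (no_types, lifting) mult.assoc nonzero_eq_divide_eq norm_eq_zero of_real_divide of_real_eq_0_iff times_divide_eq_left)
    then have "p l - p i = of_real (norm (z l) / norm (z m)) * (p m - p i)"
      unfolding zd by (metis mult.left_commute)
    then have "det3 (p i) (p l) (p m) = 0"
      by (simp add: det3_cross)
    moreover have "i \<noteq> l" "i \<noteq> m" using that by (auto simp: neighbours_def)
    ultimately show False using general_position_det3[OF gp, of i l m] that by auto
  qed
  have angle: "ccw_angle p i j l = 2 * pi + ang l - ang j" if "l \<in> ?N" "l \<noteq> j" for l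
    unfolding ccw_angle_def
  proof (rule Arg2pi_unique)
    have "(p l - p i) / (p j - p i) = z l / z j" using d0 by (simp add: zd)
    also have "\<dots> = of_real (norm (z l) / norm (z j)) * (exp (\<i> * of_real (ang l)) / exp (\<i> * of_real (ang j)))"
      using zang[OF that(1)] zang[OF j(1)] by (metis of_real_divide times_divide_times_eq)
    also have "\<dots> = of_real (norm (z l) / norm (z j)) * exp (\<i> * of_real (2 * pi + ang l - ang j))"
      by (simp add: exp_diff[symmetric] exp_add algebra_simps)
         (simp add: exp_diff exp_add exp_two_pi_i' mult.commute)
    finally show "of_real (norm (z l) / norm (z j)) * exp (\<i> * of_real (2 * pi + ang l - ang j))
       = (p l - p i) / (p j - p i)" by simp
    show "0 < norm (z l) / norm (z j)" using z0[OF that(1)] z0[OF j(1)] by simp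
    show "0 \<le> 2 * pi + ang l - ang j" using ang[OF that(1)] ang[OF j(1)] by linarith
    show "2 * pi + ang l - ang j < 2 * pi"
      using j(2)[OF that(1)] distinct[OF that(1) j(1) that(2)] by simp
  qed
  have "k \<noteq> j"
  proof
    assume "k = j"
    then have "ang l = ang j" if "l \<in> ?N" for l using j(2)[OF that] k(2)[OF that] by simp
    then have "?N \<subseteq> {j}" using distinct j(1) by blast
    then have "card ?N \<le> card {j}" by (intro card_mono) auto
    then show False using False by simp
  qed
  moreover have "ccw_angle p i j k > pi"
    using angle[OF k(1) \<open>k \<noteq> j\<close>] ang[OF k(1)] ang[OF j(1)] by linarith
  moreover have "\<not> ccw_angle p i j l < ccw_angle p i j k" if "l \<in> ?N" "l \<noteq> j" for l
    using angle[OF that] angle[OF k(1) \<open>k \<noteq> j\<close>] k(2)[OF that(1)] by simp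
  ultimately show ?thesis
    unfolding pointed_at_def using j(1) k(1)
    by (intro disjI2 bexI[of _ j] bexI[of _ k] conjI) auto
qed

section \<open>Self-stresses nonnegative off a pointed non-crossing graph\<close>

lemma injective_shear_exists:
  fixes p :: "'n::finite \<Rightarrow> complex"
  assumes "inj p"
  obtains s where "inj (\<lambda>i. Re (p i) + s * Im (p i))"
proof -
  have "finite (range (\<lambda>(i, j). - (Re (p i) - Re (p j)) / (Im (p i) - Im (p j))))"
    by simp
  \<comment> \<open>Each pair with different ordinates forbids one shear; for equal ordinates the
    division by zero yields the value \<open>0\<close>, which does no harm.\<close>
  then obtain s where s: "s \<notin> range (\<lambda>(i, j). - (Re (p i) - Re (p j)) / (Im (p i) - Im (p j)))"
    using ex_new_if_finite[OF infinite_UNIV_char_0] by blast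
  have "i = j" if eq: "Re (p i) + s * Im (p i) = Re (p j) + s * Im (p j)" for i j
  proof (cases "Im (p i) = Im (p j)")
    case True
    then have "p i = p j" using eq by (simp add: complex_eq_iff)
    then show ?thesis using assms by (simp add: inj_eq)
  next
    case False
    then have "s = (\<lambda>(i, j). - (Re (p i) - Re (p j)) / (Im (p i) - Im (p j))) (i, j)"
      using eq by (simp add: field_simps)
    then show ?thesis using s by blast
  qed
  then show thesis by (intro that injI)
qed

text \<open>The Airy argument in sheared coordinates. A shear preserves areas, so \<open>dd\<close>
  becomes \<open>det3\<close> and the energy is unchanged; edges, incidences and half-planes carry
  over.\<close>

lemma stress_zero_if_energy_nonneg:
  fixes p :: "'n::finite \<Rightarrow> complex" and w :: "'n \<Rightarrow> 'n \<Rightarrow> real"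
  assumes gp: "general_position p"
    and G: "G \<in> pointed_noncrossing_graphs p"
    and sym: "\<And>i j. w i j = w j i"
    and equilibrium: "\<And>i. (\<Sum>j\<in>UNIV. w i j *\<^sub>R (p j - p i)) = 0"
    and nonneg: "\<And>i j. i \<noteq> j \<Longrightarrow> {i, j} \<notin> G \<Longrightarrow> 0 \<le> w i j"
    and energy: "0 \<le> (\<Sum>i\<in>UNIV. \<Sum>j\<in>UNIV. w i j * (det3 a (p i) (p j) * det3 b (p i) (p j)))"
    and "i \<noteq> j"
  shows "w i j = 0"
proof -
  have inj: "inj p" using gp by (simp add: general_position_def)
  obtain s where s: "inj (\<lambda>i. Re (p i) + s * Im (p i))"
    using injective_shear_exists[OF inj] by blast
  define x where "x i = Re (p i) + s * Im (p i)" for i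
  define y where "y i = Im (p i)" for i
  have eqIm: "(\<Sum>j\<in>UNIV. w i j * (Im (p j) - Im (p i))) = 0" for i
    using arg_cong[OF equilibrium[of i], of Im] by simp
  have eqRe: "(\<Sum>j\<in>UNIV. w i j * (Re (p j) - Re (p i))) = 0" for i
    using arg_cong[OF equilibrium[of i], of Re] by simp
  interpret planar_stress x y w
  proof
    show "inj x" using s by (simp add: x_def[abs_def])
    show "w i j = w j i" for i j by (rule sym)
    show "(\<Sum>j\<in>UNIV. w i j * (y j - y i)) = 0" for i using eqIm by (simp add: y_def)
    have "(\<Sum>j\<in>UNIV. w i j * (x j - x i)) =
       (\<Sum>j\<in>UNIV. w i j * (Re (p j) - Re (p i))) + s * (\<Sum>j\<in>UNIV. w i j * (Im (p j) - Im (p i)))" for i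
      unfolding sum_distrib_left sum.distrib[symmetric]
      by (intro sum.cong refl) (simp add: x_def algebra_simps)
    then show "(\<Sum>j\<in>UNIV. w i j * (x j - x i)) = 0" for i using eqRe eqIm by simp
    show "(x j - x i) * (y k - y i) \<noteq> (x k - x i) * (y j - y i)" if "i \<noteq> j" "j \<noteq> k" "i \<noteq> k" for i j k
    proof -
      have "(x j - x i) * (y k - y i) - (x k - x i) * (y j - y i) = det3 (p i) (p j) (p k)"
        by (simp add: x_def y_def det3_def algebra_simps)
      then show ?thesis using general_position_det3[OF gp that] by auto
    qed
  qed
  have dd: "dd i j (Re c + s * Im c, Im c) = det3 c (p i) (p j)" for i j c
    by (simp add: dd_def x_def y_def det3_def algebra_simps)
  have mid: "\<exists>d. d \<noteq> 0 \<and> 2 * airy q \<le> airy (q + d) + airy (q - d)" for q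
  proof (cases "\<exists>k. (x k, y k) = q")
    case False
    show ?thesis
    proof (rule airy_midpoint_nonvertex[where G = "\<lambda>i j. {i, j} \<in> G"])
      show "(x k, y k) \<noteq> q" for k using False by blast
      show "0 \<le> w i j" if "i \<noteq> j" "{i, j} \<notin> G" for i j using nonneg that .
      \<comment> \<open>\<open>z\<close> is the point \<open>q\<close> in the original
        coordinates.\<close>
      define z where "z = Complex (fst q - s * snd q) (snd q)"
      have on_segment: "z \<in> closed_segment (p i) (p j)"
        if "x i \<le> fst q" "fst q < x j" "dd i j q = 0" for i j
      proof -
        define u where "u = (fst q - x i) / (x j - x i)"
        have u: "0 \<le> u" "u \<le> 1" using that by (auto simp: u_def)
        have xu: "(x j - x i) * u = fst q - x i" using that by (simp add: u_def)
        then have X: "fst q = (1 - u) * x i + u * x j" by (simp add: algebra_simps)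
        have "(x j - x i) * snd q = (x j - x i) * ((1 - u) * y i + u * y j)"
          using that(3) xu unfolding dd_def by algebra
        then have Y: "snd q = (1 - u) * y i + u * y j" using that by simp
        have "z = (1 - u) *\<^sub>R p i + u *\<^sub>R p j"
          by (rule complex_eqI) (simp_all add: z_def X Y, simp_all add: x_def y_def algebra_simps)
        then show ?thesis using u by (auto simp: closed_segment_def)
      qed
      fix i j k l
      assume h: "{i, j} \<in> G" "{k, l} \<in> G" "x i \<le> fst q" "fst q < x j"
        "x k \<le> fst q" "fst q < x l" "dd i j q = 0" "dd k l q = 0"
      have "z \<notin> range p"
      proof
        assume "z \<in> range p"
        then obtain m where "p m = z" by auto
        then have "(x m, y m) = q" by (cases q) (simp add: x_def y_def z_def)
        then show False using False by blast
      qed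
      moreover have "z \<in> closed_segment (p i) (p j) \<inter> closed_segment (p k) (p l)"
        using on_segment h by blast
      ultimately have "{i, j} = {k, l}"
        using G h(1,2) unfolding pointed_noncrossing_graphs_def non_crossing_def by blast
      then show "i = k \<and> j = l" using h(3-6) by (auto simp: doubleton_eq_iff)
    qed
  next
    case True
    then obtain k where k: "q = (x k, y k)" by blast
    have "pointed_at p G k"
      using G by (simp add: pointed_noncrossing_graphs_def pointed_def)
    then obtain n where n: "\<And>j. j \<in> neighbours G k \<Longrightarrow> inner n (p j - p k) > 0"
      using pointed_at_imp_halfplane[OF gp] by blast
    \<comment> \<open>\<open>(Re n, \<beta>)\<close> is the normal of the half-plane in sheared
      coordinates. It is then perturbed to make its second entry nonzero, since the boundary line
      must not be vertical; finitely many strict inequalities survive this.\<close>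
    define \<beta> where "\<beta> = Im n - s * Re n"
    have in_n: "inner n (p j - p k) = Re n * (x j - x k) + \<beta> * (y j - y k)" for j
      by (simp add: inner_complex_def \<beta>_def x_def y_def algebra_simps)
    have "\<forall>\<^sub>F t in at_right 0. \<forall>j\<in>neighbours G k. Re n * (x j - x k) + (\<beta> + t) * (y j - y k) > 0"
    proof (intro eventually_ball_finite ballI)
      fix j assume j: "j \<in> neighbours G k"
      have "((\<lambda>t. Re n * (x j - x k) + (\<beta> + t) * (y j - y k)) \<longlongrightarrow>
          Re n * (x j - x k) + (\<beta> + 0) * (y j - y k)) (at_right 0)"
        by (intro tendsto_intros)
      then show "\<forall>\<^sub>F t in at_right 0. Re n * (x j - x k) + (\<beta> + t) * (y j - y k) > 0"
        using n[OF j] by (intro order_tendstoD(1)) (auto simp: in_n)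
    qed simp
    moreover have "\<forall>\<^sub>F t in at_right 0. \<beta> + t \<noteq> 0"
    proof (cases "\<beta> < 0")
      case True
      have "((\<lambda>t. \<beta> + t) \<longlongrightarrow> \<beta> + 0) (at_right 0)" by (intro tendsto_intros)
      then have "\<forall>\<^sub>F t in at_right 0. \<beta> + t < 0" using True by (intro order_tendstoD(2)) auto
      then show ?thesis by eventually_elim simp
    next
      case False
      have "\<forall>\<^sub>F t in at_right 0. (0::real) < t" by (rule eventually_at_right_less)
      then show ?thesis by eventually_elim (use False in auto)
    qed
    ultimately have "\<forall>\<^sub>F t in at_right 0. \<beta> + t \<noteq> 0 \<and>
       (\<forall>j\<in>neighbours G k. Re n * (x j - x k) + (\<beta> + t) * (y j - y k) > 0)"
      by eventually_elim blast
    then obtain \<gamma> where \<gamma>: "\<gamma> \<noteq> 0"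
      "\<And>j. j \<in> neighbours G k \<Longrightarrow> Re n * (x j - x k) + \<gamma> * (y j - y k) > 0"
      using eventually_happens'[OF trivial_limit_at_right_real] by blast
    \<comment> \<open>The direction is that of the boundary line of the half-plane with normal
      \<open>(Re n, \<gamma>)\<close>, oriented to the right.\<close>
    show ?thesis unfolding k
    proof (rule airy_midpoint_vertex[where G = "\<lambda>i j. j \<in> neighbours G i" and
          d = "(\<bar>\<gamma>\<bar>, - sgn \<gamma> * Re n)" and s = "- sgn \<gamma>"])
      show "0 < fst (\<bar>\<gamma>\<bar>, - sgn \<gamma> * Re n)" using \<gamma> by simp
      show "\<bar>- sgn \<gamma>\<bar> = 1" using \<gamma> by (simp add: abs_sgn_eq)
      show "0 \<le> w k j" if "j \<noteq> k" "j \<notin> neighbours G k" for j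
        using nonneg[of k j] that by (auto simp: neighbours_def)
      show "0 < - sgn \<gamma> * (snd (\<bar>\<gamma>\<bar>, - sgn \<gamma> * Re n) * (x j - x k) - fst (\<bar>\<gamma>\<bar>, - sgn \<gamma> * Re n) * (y j - y k))"
        if "j \<in> neighbours G k" for j
        using \<gamma>(2)[OF that] \<gamma>(1) by (cases "\<gamma> > 0") (auto simp: algebra_simps)
    qed
  qed
  obtain R where R: "\<And>q. R \<le> \<bar>fst q\<bar> \<or> R \<le> \<bar>snd q\<bar> \<Longrightarrow> airy q = 0"
    using airy_support by metis
  have "airy q \<le> 0" for q
  proof (rule midpoint_max_principle[where h = airy and R = "2 * R"])
    show "continuous_on UNIV airy" by (simp add: continuous_at_imp_continuous_on isCont_airy)
    show "airy q \<le> 0" if "2 * R < norm q" for q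
    proof -
      have "norm q \<le> \<bar>fst q\<bar> + \<bar>snd q\<bar>"
        by (cases q) (simp add: norm_prod_def sqrt_sum_squares_le_sum_abs)
      then have "R \<le> \<bar>fst q\<bar> \<or> R \<le> \<bar>snd q\<bar>" using that by linarith
      then show ?thesis using R by simp
    qed
  qed (rule mid)
  then show ?thesis
    using stress_zero_if_airy_nonpos[of "(Re a + s * Im a, Im a)" "(Re b + s * Im b, Im b)" i j]
      energy \<open>i \<noteq> j\<close> by (simp add: dd)
qed

section \<open>Tight graphs are pointed and non-crossing\<close>

text \<open>With \<open>c\<close> as origin, \<open>det3 a z z'\<close> is
  \<open>det3 c z z'\<close> plus a linear form in \<open>z - z'\<close>, and likewise for
  \<open>b\<close>. So every term of the product other than the square has such a form as a factor,
  and \<open>W\<close> is the field whose strain they are.\<close>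

lemma det3_product_eq_square_plus_motion:
  obtains W :: "complex \<Rightarrow> complex" where
    "\<And>z z'. det3 a z z' * det3 b z z' = (det3 c z z')\<^sup>2 + inner (z - z') (W z - W z')"
proof -
  define a1 a2 b1 b2 where "a1 = Re a - Re c" "a2 = Im a - Im c" "b1 = Re b - Re c" "b2 = Im b - Im c"
  note defs = this
  define W where "W z = (let x = Re z - Re c; y = Im z - Im c in
     Complex (- (a2 + b2) * x * y + (a1 + b1) * y\<^sup>2 + a2 * b2 * x - (a1 * b2 + a2 * b1) * y)
       ((a2 + b2) * x\<^sup>2 - (a1 + b1) * x * y + a1 * b1 * y))" for z
  have "det3 a z z' * det3 b z z' = (det3 c z z')\<^sup>2 + inner (z - z') (W z - W z')" for z z'
  proof -
    define x y x' y' where "x = Re z - Re c" "y = Im z - Im c" "x' = Re z' - Re c" "y' = Im z' - Im c"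
    note defs' = this
    have A: "det3 a z z' = (x - a1) * (y' - a2) - (x' - a1) * (y - a2)"
      and B: "det3 b z z' = (x - b1) * (y' - b2) - (x' - b1) * (y - b2)"
      and C: "det3 c z z' = x * y' - x' * y"
      by (simp_all add: det3_def defs defs' algebra_simps)
    have Z: "Re (z - z') = x - x'" "Im (z - z') = y - y'" by (simp_all add: defs')
    show ?thesis
      unfolding A B C inner_complex_def Z W_def Let_def defs'[symmetric]
      by (simp add: power2_eq_square algebra_simps)
  qed
  then show thesis by (rule that)
qed

text \<open>Expanding the inner product gives four sums, each with one of the two vanishing sums as
  a factor.\<close>

lemma affine_dependency_sum_inner:
  fixes p v :: "'n::finite \<Rightarrow> 'a::real_inner"
  assumes "(\<Sum>k\<in>UNIV. \<mu> k) = 0" "(\<Sum>k\<in>UNIV. \<mu> k *\<^sub>R p k) = 0"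
  shows "(\<Sum>k\<in>UNIV. \<Sum>l\<in>UNIV. \<mu> k * \<mu> l * inner (p k - p l) (v k - v l)) = 0"
proof -
  have 1: "(\<Sum>k\<in>UNIV. \<Sum>l\<in>UNIV. \<mu> k * \<mu> l * inner (p k) (v k)) = 0"
  proof -
    have "(\<Sum>k\<in>UNIV. \<Sum>l\<in>UNIV. \<mu> k * \<mu> l * inner (p k) (v k))
      = (\<Sum>k\<in>UNIV. \<mu> k * inner (p k) (v k)) * (\<Sum>l\<in>UNIV. \<mu> l)"
      unfolding sum_product by (intro sum.cong refl) simp
    then show ?thesis using assms(1) by simp
  qed
  have 2: "(\<Sum>k\<in>UNIV. \<Sum>l\<in>UNIV. \<mu> k * \<mu> l * inner (p l) (v l)) = 0"
    by (subst sum.swap) (use 1 in \<open>simp add: mult.commute\<close>)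
  have 3: "(\<Sum>k\<in>UNIV. \<Sum>l\<in>UNIV. \<mu> k * \<mu> l * inner (p k) (v l)) = 0"
  proof -
    have "(\<Sum>k\<in>UNIV. \<Sum>l\<in>UNIV. \<mu> k * \<mu> l * inner (p k) (v l))
      = inner (\<Sum>k\<in>UNIV. \<mu> k *\<^sub>R p k) (\<Sum>l\<in>UNIV. \<mu> l *\<^sub>R v l)"
      unfolding inner_sum_left inner_sum_right by (subst sum.swap, intro sum.cong refl) simp
    then show ?thesis using assms(2) by simp
  qed
  have 4: "(\<Sum>k\<in>UNIV. \<Sum>l\<in>UNIV. \<mu> k * \<mu> l * inner (p l) (v k)) = 0"
    by (subst sum.swap) (use 3 in \<open>simp add: mult.commute\<close>)
  have "(\<Sum>k\<in>UNIV. \<Sum>l\<in>UNIV. \<mu> k * \<mu> l * inner (p k - p l) (v k - v l))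
     = (\<Sum>k\<in>UNIV. \<Sum>l\<in>UNIV. \<mu> k * \<mu> l * inner (p k) (v k) + \<mu> k * \<mu> l * inner (p l) (v l)
        - \<mu> k * \<mu> l * inner (p k) (v l) - \<mu> k * \<mu> l * inner (p l) (v k))"
    by (intro sum.cong refl) (simp add: inner_diff_left inner_diff_right algebra_simps)
  then show ?thesis
    using 1 2 3 4 by (simp add: sum.distrib sum_subtractf)
qed

text \<open>The product is a square plus the strain of \<open>W\<close>, so this is the preceding
  identity for the velocities \<open>v k - W (p k)\<close>.\<close>

lemma affine_dependency_slack:
  fixes p v :: "'n::finite \<Rightarrow> complex"
  assumes "(\<Sum>k\<in>UNIV. \<mu> k) = 0" "(\<Sum>k\<in>UNIV. \<mu> k *\<^sub>R p k) = 0"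
  shows "(\<Sum>k\<in>UNIV. \<Sum>l\<in>UNIV. \<mu> k * \<mu> l *
     (inner (p k - p l) (v k - v l) - det3 a (p k) (p l) * det3 b (p k) (p l)
       + (det3 c (p k) (p l))\<^sup>2)) = 0"
proof -
  obtain W where W: "\<And>z z'. det3 a z z' * det3 b z z' = (det3 c z z')\<^sup>2 + inner (z - z') (W z - W z')"
    using det3_product_eq_square_plus_motion[of a b c] by blast
  have "inner (p k - p l) (v k - v l) - det3 a (p k) (p l) * det3 b (p k) (p l) + (det3 c (p k) (p l))\<^sup>2
     = inner (p k - p l) ((v k - W (p k)) - (v l - W (p l)))" for k l
    by (simp add: W inner_diff_right)
  then show ?thesis
    using affine_dependency_sum_inner[OF assms, of "\<lambda>k. v k - W (p k)"] by simp
qed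

lemma det3_affine_first:
  "det3 ((1 - s) *\<^sub>R a + s *\<^sub>R b) c d = (1 - s) * det3 a c d + s * det3 b c d"
  by (simp add: det3_def algebra_simps)

lemma det3_degenerate [simp]: "det3 a b b = 0" "det3 a a b = 0" "det3 a b a = 0"
  by (simp_all add: det3_def algebra_simps)

locale expansive_motion =
  fixes p v :: "'n::finite \<Rightarrow> complex" and a b :: complex
  assumes gp: "general_position p"
    and expansive: "i \<noteq> j \<Longrightarrow>
      det3 a (p i) (p j) * det3 b (p i) (p j) \<le> inner (p i - p j) (v i - v j)"
begin

definition tight :: "'n \<Rightarrow> 'n \<Rightarrow> bool" where
  "tight i j \<longleftrightarrow> i \<noteq> j \<and> inner (p i - p j) (v i - v j) = det3 a (p i) (p j) * det3 b (p i) (p j)"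

lemma tight_sym: "tight i j \<Longrightarrow> tight j i"
proof -
  have "inner (p j - p i) (v j - v i) = inner (p i - p j) (v i - v j)"
    by (metis inner_minus_left inner_minus_right minus_diff_eq minus_minus)
  moreover have "det3 a (p j) (p i) * det3 b (p j) (p i) = det3 a (p i) (p j) * det3 b (p i) (p j)"
    by (simp add: det3_def algebra_simps)
  ultimately show "tight i j \<Longrightarrow> tight j i" by (auto simp: tight_def)
qed

text \<open>The gap in the inequality plus a square depending on \<open>c\<close>. For distinct
  \<open>k\<close> and \<open>l\<close> it vanishes only if the pair is tight and its line passes
  through \<open>c\<close>; \<open>c\<close> will be chosen accordingly.\<close>

definition slack :: "complex \<Rightarrow> 'n \<Rightarrow> 'n \<Rightarrow> real" where
  "slack c k l = inner (p k - p l) (v k - v l) - det3 a (p k) (p l) * det3 b (p k) (p l)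
     + (det3 c (p k) (p l))\<^sup>2"

lemma slack_nonneg: "0 \<le> slack c k l"
  using expansive[of k l] by (cases "k = l") (auto simp: slack_def)

lemma slack_zero_imp_det3: "slack c k l = 0 \<Longrightarrow> det3 c (p k) (p l) = 0"
proof (cases "k = l")
  case False
  assume "slack c k l = 0"
  then have "(det3 c (p k) (p l))\<^sup>2 \<le> 0" 
    unfolding slack_def using expansive[OF False] by linarith
  then show ?thesis by simp
qed simp

lemma slack_tight: "tight k l \<Longrightarrow> det3 c (p k) (p l) = 0 \<Longrightarrow> slack c k l = 0"
  by (simp add: slack_def tight_def)

lemma slack_self [simp]: "slack c k k = 0"
  by (simp add: slack_def)

lemma sum_slack_zero:
  assumes "(\<Sum>k\<in>UNIV. \<mu> k) = 0" "(\<Sum>k\<in>UNIV. \<mu> k *\<^sub>R p k) = 0"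
  shows "(\<Sum>k\<in>UNIV. \<Sum>l\<in>UNIV. \<mu> k * \<mu> l * slack c k l) = 0"
  unfolding slack_def by (rule affine_dependency_slack[OF assms])

text \<open>Let \<open>c\<close> be a common point \<open>z\<close>. Pairs within an edge have zero
  \<open>slack\<close>, and for mixed pairs the product of coefficients is nonpositive. So all terms
  vanish, which makes \<open>z\<close>, \<open>p i\<close>, \<open>p k\<close> collinear, against
  general position.\<close>

lemma tight_edges_not_crossing:
  assumes ij: "tight i j" and kl: "tight k l" and disj: "{i, j} \<inter> {k, l} = {}"
  shows "closed_segment (p i) (p j) \<inter> closed_segment (p k) (p l) = {}"
proof (rule ccontr)
  assume "\<not> ?thesis"
  then obtain z where "z \<in> closed_segment (p i) (p j)" "z \<in> closed_segment (p k) (p l)" by auto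
  then obtain s t where s: "0 \<le> s" "s \<le> 1" and zs: "z = (1 - s) *\<^sub>R p i + s *\<^sub>R p j"
    and t: "0 \<le> t" "t \<le> 1" and zt: "z = (1 - t) *\<^sub>R p k + t *\<^sub>R p l"
    unfolding closed_segment_def by blast
  have d: "i \<noteq> j" "k \<noteq> l" "i \<noteq> k" "i \<noteq> l" "j \<noteq> k" "j \<noteq> l"
    using ij kl disj by (auto simp: tight_def)
  have zij: "det3 z (p i) (p j) = 0" unfolding zs det3_affine_first by simp
  have zkl: "det3 z (p k) (p l) = 0" unfolding zt det3_affine_first by simp
  have zji: "det3 z (p j) (p i) = 0" unfolding zs det3_affine_first by simp
  have zlk: "det3 z (p l) (p k) = 0" unfolding zt det3_affine_first by simp
  have "s \<noteq> 0"
  proof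
    assume "s = 0"
    then have "det3 (p i) (p k) (p l) = 0" using zkl zs by simp
    then show False using general_position_det3[OF gp, of i k l] d by auto
  qed
  have "s \<noteq> 1"
  proof
    assume "s = 1"
    then have "det3 (p j) (p k) (p l) = 0" using zkl zs by simp
    then show False using general_position_det3[OF gp, of j k l] d by auto
  qed
  have "t \<noteq> 1"
  proof
    assume "t = 1"
    then have "det3 (p l) (p i) (p j) = 0" using zij zt by simp
    then show False using general_position_det3[OF gp, of l i j] d by auto
  qed
  \<comment> \<open>The dependency equates the two expressions of \<open>z\<close> as a convex
    combination of endpoints.\<close>
  define \<mu> where "\<mu> m = (if m = i then 1 - s else 0) + (if m = j then s else 0)
      - (if m = k then 1 - t else 0) - (if m = l then t else 0)" for m
  have sum1: "(\<Sum>m\<in>UNIV. \<mu> m) = 0"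
    unfolding \<mu>_def by (simp add: sum.distrib sum_subtractf)
  have sum2: "(\<Sum>m\<in>UNIV. \<mu> m *\<^sub>R p m) = 0"
  proof -
    have "\<mu> m *\<^sub>R p m = (if m = i then (1 - s) *\<^sub>R p i else 0) + (if m = j then s *\<^sub>R p j else 0)
      - (if m = k then (1 - t) *\<^sub>R p k else 0) - (if m = l then t *\<^sub>R p l else 0)" for m
      unfolding \<mu>_def by (simp add: scaleR_add_left scaleR_diff_left)
    then have "(\<Sum>m\<in>UNIV. \<mu> m *\<^sub>R p m) = (1 - s) *\<^sub>R p i + s *\<^sub>R p j - (1 - t) *\<^sub>R p k - t *\<^sub>R p l"
      by (simp add: sum.distrib sum_subtractf)
    also have "\<dots> = z - z" by (subst (2) zt, subst zs) simp
    finally show ?thesis by simp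
  qed
  have terms: "0 \<le> - (\<mu> m * \<mu> n * slack z m n)" for m n
  proof -
    have pos: "0 \<le> \<mu> m" if "m \<in> {i, j}" for m using that s d by (auto simp: \<mu>_def)
    have neg: "\<mu> m \<le> 0" if "m \<in> {k, l}" for m using that t d by (auto simp: \<mu>_def)
    have zero: "\<mu> m = 0" if "m \<notin> {i, j}" "m \<notin> {k, l}" for m using that by (auto simp: \<mu>_def)
    have sl: "slack z m n = 0" if "m \<in> {i, j} \<and> n \<in> {i, j} \<or> m \<in> {k, l} \<and> n \<in> {k, l}"
      using that slack_tight[OF ij zij] slack_tight[OF tight_sym[OF ij] zji]
        slack_tight[OF kl zkl] slack_tight[OF tight_sym[OF kl] zlk] by auto
    have "\<mu> m * \<mu> n \<le> 0" if "m \<in> {i, j} \<and> n \<in> {k, l} \<or> m \<in> {k, l} \<and> n \<in> {i, j}"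
      using that pos neg by (metis mult_nonneg_nonpos mult_nonpos_nonneg)
    then show ?thesis
      using sl zero[of m] zero[of n] slack_nonneg[of z m n]
      by (cases "m \<in> {i, j}"; cases "m \<in> {k, l}"; cases "n \<in> {i, j}"; cases "n \<in> {k, l}")
        (auto simp: mult_nonpos_nonneg)
  qed
  have "(\<Sum>m\<in>UNIV. \<Sum>n\<in>UNIV. - (\<mu> m * \<mu> n * slack z m n)) = 0"
    using sum_slack_zero[OF sum1 sum2, of z] by (simp add: sum_negf)
  then have "- (\<mu> i * \<mu> k * slack z i k) = 0"
    using terms by (auto simp: sum_nonneg_eq_0_iff sum_nonneg)
  moreover have "\<mu> i \<noteq> 0" "\<mu> k \<noteq> 0" using d \<open>s \<noteq> 1\<close> \<open>t \<noteq> 1\<close> by (auto simp: \<mu>_def)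
  ultimately have "det3 z (p i) (p k) = 0" by (auto dest: slack_zero_imp_det3)
  then have "s * det3 (p j) (p i) (p k) = 0" unfolding zs det3_affine_first by simp
  then show False using \<open>s \<noteq> 0\<close> general_position_det3[OF gp, of j i k] d by auto
qed

text \<open>Otherwise \<open>p i\<close> is a convex combination of its tight neighbours. With
  \<open>c = p i\<close> the terms containing \<open>i\<close> vanish and the others are
  nonnegative, hence all vanish; two neighbours of positive weight would be collinear with
  \<open>p i\<close>.\<close>

lemma tight_star_halfplane:
  obtains d where "\<And>j. tight i j \<Longrightarrow> inner d (p j - p i) > 0"
proof -
  let ?N = "{j. tight i j}"
  let ?S = "(\<lambda>j. p j - p i) ` ?N"
  have "0 \<notin> convex hull ?S"
  proof
    assume "0 \<in> convex hull ?S"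
    then obtain u where u: "\<And>z. z \<in> ?S \<Longrightarrow> 0 \<le> u z" "sum u ?S = 1" "(\<Sum>z\<in>?S. u z *\<^sub>R z) = 0"
      by (auto simp: convex_hull_finite)
    have inj: "inj_on (\<lambda>j. p j - p i) ?N"
      using gp by (auto simp: general_position_def inj_on_def)
    define c where "c j = u (p j - p i)" for j
    have c: "0 \<le> c j" if "tight i j" for j using u(1) that by (auto simp: c_def)
    have c1: "(\<Sum>j\<in>?N. c j) = 1" using u(2) unfolding sum.reindex[OF inj] c_def by simp
    have c0: "(\<Sum>j\<in>?N. c j *\<^sub>R (p j - p i)) = 0"
      using u(3) unfolding sum.reindex[OF inj] c_def by simp
    have iN: "i \<notin> ?N" by (simp add: tight_def)
    define \<mu> where "\<mu> m = (if m = i then -1 else if tight i m then c m else 0)" for m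
    have UN: "sum h UNIV = h i + sum h ?N" if "\<And>m. m \<noteq> i \<Longrightarrow> \<not> tight i m \<Longrightarrow> h m = 0"
      for h :: "'n \<Rightarrow> 'x::comm_monoid_add"
    proof -
      have "sum h UNIV = sum h (insert i ?N)"
        using that by (intro sum.mono_neutral_right) auto
      then show ?thesis using iN by simp
    qed
    have \<mu>N: "\<mu> m = c m" if "m \<in> ?N" for m using that iN by (auto simp: \<mu>_def)
    have sum1: "(\<Sum>m\<in>UNIV. \<mu> m) = 0"
    proof -
      have "sum \<mu> ?N = sum c ?N" by (intro sum.cong) (auto simp: \<mu>N)
      then show ?thesis by (subst UN) (auto simp: \<mu>_def c1)
    qed
    have "(\<Sum>m\<in>UNIV. \<mu> m *\<^sub>R p m) = - p i + (\<Sum>j\<in>?N. c j *\<^sub>R p j)"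
    proof -
      have "(\<Sum>m\<in>?N. \<mu> m *\<^sub>R p m) = (\<Sum>j\<in>?N. c j *\<^sub>R p j)" by (intro sum.cong) (auto simp: \<mu>N)
      then show ?thesis by (subst UN) (auto simp: \<mu>_def)
    qed
    also have "(\<Sum>j\<in>?N. c j *\<^sub>R p j) = (\<Sum>j\<in>?N. c j *\<^sub>R (p j - p i)) + (\<Sum>j\<in>?N. c j) *\<^sub>R p i"
      by (simp add: scaleR_diff_right sum_subtractf scaleR_left.sum)
    finally have sum2: "(\<Sum>m\<in>UNIV. \<mu> m *\<^sub>R p m) = 0" using c0 c1 by simp
    have terms: "0 \<le> \<mu> m * \<mu> n * slack (p i) m n" for m n
    proof (cases "m = i \<or> n = i")
      case True
      then have "\<mu> m * \<mu> n * slack (p i) m n = 0"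
      proof
        assume m: "m = i"
        show ?thesis
          using slack_tight[of i n "p i"] m by (cases "tight i n"; cases "n = i") (auto simp: \<mu>_def)
      next
        assume n: "n = i"
        show ?thesis
          using slack_tight[OF tight_sym, of i m "p i"] n by (cases "tight i m"; cases "m = i") (auto simp: \<mu>_def)
      qed
      then show ?thesis by (rule eq_refl[OF sym])
    next
      case False
      then have "0 \<le> \<mu> m" "0 \<le> \<mu> n" using c by (auto simp: \<mu>_def)
      then show ?thesis using slack_nonneg by simp
    qed
    have all0: "\<mu> m * \<mu> n * slack (p i) m n = 0" for m n
      using sum_slack_zero[OF sum1 sum2, of "p i"] terms
      by (auto simp: sum_nonneg_eq_0_iff sum_nonneg)
    obtain m where m: "m \<in> ?N" "c m \<noteq> 0"
      using c1 by (metis sum.neutral zero_neq_one)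
    \<comment> \<open>All the weight sits on the single neighbour \<open>m\<close>, whose point
      would then coincide with \<open>p i\<close>.\<close>
    have "c n = 0" if "n \<in> ?N" "n \<noteq> m" for n
    proof (rule ccontr)
      assume "c n \<noteq> 0"
      then have "slack (p i) m n = 0" using all0[of m n] m that \<mu>N by simp
      then have "det3 (p i) (p m) (p n) = 0" by (rule slack_zero_imp_det3)
      then show False using general_position_det3[OF gp, of i m n] m that iN by auto
    qed
    then have "(\<Sum>j\<in>?N. c j *\<^sub>R (p j - p i)) = (\<Sum>j\<in>{m}. c j *\<^sub>R (p j - p i))"
      using m by (intro sum.mono_neutral_right) auto
    then have "p m = p i" using c0 m by simp
    then show False using gp m iN by (auto simp: general_position_def inj_eq)
  qed
  moreover have "closed (convex hull ?S)"
    by (intro compact_imp_closed finite_imp_compact_convex_hull) simp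
  ultimately obtain d \<beta> where "0 < \<beta>" "\<And>z. z \<in> convex hull ?S \<Longrightarrow> \<beta> < inner d z"
    using separating_hyperplane_closed_0[of "convex hull ?S"] by (auto simp: convex_convex_hull)
  then have "inner d (p j - p i) > 0" if "tight i j" for j
    using that by (metis (no_types, lifting) hull_inc imageI mem_Collect_eq order_less_trans)
  then show thesis by (rule that)
qed

lemma tight_graph_pointed_noncrossing:
  "{{i, j} |i j. tight i j} \<in> pointed_noncrossing_graphs p"
proof -
  let ?G = "{{i, j} |i j. tight i j}"
  have edge: "{i, j} \<in> ?G \<longleftrightarrow> tight i j" for i j
    using tight_sym by (auto simp: doubleton_eq_iff)
  have "is_graph ?G" by (auto simp: is_graph_def tight_def)
  moreover have "non_crossing p ?G"
    unfolding non_crossing_def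
  proof (intro allI impI)
    \<comment> \<open>Edges with a common endpoint are handled by general position alone.\<close>
    have shared: "closed_segment (p i) (p j) \<inter> closed_segment (p i) (p l) \<subseteq> {p i}"
      if "i \<noteq> j" "i \<noteq> l" "j \<noteq> l" for i j l
    proof
      fix z assume z: "z \<in> closed_segment (p i) (p j) \<inter> closed_segment (p i) (p l)"
      then obtain s t where s: "z = (1 - s) *\<^sub>R p i + s *\<^sub>R p j" and t: "z = (1 - t) *\<^sub>R p i + t *\<^sub>R p l"
        unfolding closed_segment_def by blast
      have "det3 z (p i) (p l) = 0" unfolding t det3_affine_first by simp
      then have "s * det3 (p j) (p i) (p l) = 0" unfolding s det3_affine_first by simp
      then have "s = 0" using general_position_det3[OF gp, of j i l] that by auto
      then show "z \<in> {p i}" using s by simp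
    qed
    fix i j k l assume h: "{i, j} \<in> ?G \<and> {k, l} \<in> ?G \<and> {i, j} \<noteq> {k, l}"
    then have t: "tight i j" "tight k l" unfolding edge by auto
    then have ne: "i \<noteq> j" "k \<noteq> l" by (auto simp: tight_def)
    show "closed_segment (p i) (p j) \<inter> closed_segment (p k) (p l) \<subseteq> p ` ({i, j} \<inter> {k, l})"
    proof (cases "{i, j} \<inter> {k, l} = {}")
      case True
      then show ?thesis using tight_edges_not_crossing[OF t True] by simp
    next
      case False
      then consider "i = k" | "i = l" | "j = k" | "j = l" by auto
      then show ?thesis
      proof cases
        case 1
        then show ?thesis using shared[of i j l] ne h by auto
      next
        case 2
        then show ?thesis using shared[of i j k] ne h by (auto simp: closed_segment_commute)
      next
        case 3
        then show ?thesis using shared[of j i l] ne h by (auto simp: closed_segment_commute)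
      next
        case 4
        then show ?thesis using shared[of j i k] ne h by (auto simp: closed_segment_commute)
      qed
    qed
  qed
  moreover have "pointed p ?G"
    unfolding pointed_def
  proof
    fix i
    obtain d where d: "\<And>j. tight i j \<Longrightarrow> inner d (p j - p i) > 0" using tight_star_halfplane by blast
    show "pointed_at p ?G i"
      by (rule halfplane_imp_pointed_at[OF gp, of _ _ d]) (use d edge in \<open>auto simp: neighbours_def\<close>)
  qed
  ultimately show ?thesis by (simp add: pointed_noncrossing_graphs_def)
qed

end

section \<open>Existence of motions with a prescribed tight graph\<close>

lemma inner_matrix:
  fixes A B :: "real^'n^'m"
  shows "inner A B = (\<Sum>i\<in>UNIV. \<Sum>j\<in>UNIV. A $ i $ j * B $ i $ j)"
  by (simp add: inner_vec_def)

lemma inner_swap_diff: "inner (x - y) (u - v) = inner (y - x) (v - u)"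
  for x y u v :: "'a::real_inner"
  by (metis inner_minus_left inner_minus_right minus_diff_eq minus_minus)

lemma det3_swap: "det3 c z z' = - det3 c z' z"
  by (simp add: det3_def algebra_simps)

text \<open>Separation in the space of matrices: the strains of motions form the subspace
  \<open>range L\<close>, the desired strains the convex set \<open>Q\<close>. If they were
  disjoint, a separating \<open>w\<close> would be a self-stress whose signs and energy force it to
  be zero.\<close>

lemma exists_motion_with_tight_graph:
  fixes a b :: complex and p :: "'n::finite \<Rightarrow> complex"
  assumes gp: "general_position p" and G: "G \<in> pointed_noncrossing_graphs p"
  defines "f \<equiv> (\<lambda>i j. det3 a (p i) (p j) * det3 b (p i) (p j))"
  obtains u :: "'n \<Rightarrow> complex" where
    "\<And>i j. i \<noteq> j \<Longrightarrow> {i, j} \<in> G \<Longrightarrow> inner (p i - p j) (u i - u j) = f i j"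
    "\<And>i j. i \<noteq> j \<Longrightarrow> {i, j} \<notin> G \<Longrightarrow> f i j < inner (p i - p j) (u i - u j)"
proof -
  define L :: "('n \<Rightarrow> complex) \<Rightarrow> real^'n^'n" where
    "L u = (\<chi> i j. inner (p i - p j) (u i - u j))" for u
  \<comment> \<open>Only sums of opposite entries are constrained, and no diagonal entry is; this
    makes a separating \<open>w\<close> symmetric with zero diagonal.\<close>
  define Q :: "(real^'n^'n) set" where
    "Q = {z. \<forall>i j. i \<noteq> j \<longrightarrow>
       (if {i, j} \<in> G then z $ i $ j + z $ j $ i = 2 * f i j else z $ i $ j + z $ j $ i > 2 * f i j)}"
  have f_sym: "f i j = f j i" for i j
    unfolding f_def det3_swap[of _ "p i" "p j"] by simp
  have "range L \<inter> Q \<noteq> {}"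
  proof
    assume disj: "range L \<inter> Q = {}"
    have linL: "L (\<lambda>i. s *\<^sub>R u i + t *\<^sub>R v i) = s *\<^sub>R L u + t *\<^sub>R L v" for s t u v
      by (simp add: L_def vec_eq_iff inner_diff_right algebra_simps)
    have "convex (range L)"
      unfolding convex_def by (auto simp: linL[symmetric])
    moreover have "convex Q"
    proof (rule convexI)
      fix y z :: "real^'n^'n" and s t :: real
      assume yz: "y \<in> Q" "z \<in> Q" and st: "0 \<le> s" "0 \<le> t" "s + t = 1"
      show "s *\<^sub>R y + t *\<^sub>R z \<in> Q"
        unfolding Q_def
      proof (intro CollectI allI impI)
        fix i j :: 'n assume ij: "i \<noteq> j"
        let ?y = "y $ i $ j + y $ j $ i" and ?z = "z $ i $ j + z $ j $ i"
        have e: "(s *\<^sub>R y + t *\<^sub>R z) $ i $ j + (s *\<^sub>R y + t *\<^sub>R z) $ j $ i = s * ?y + t * ?z"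
          by (simp add: algebra_simps)
        show "if {i, j} \<in> G
          then (s *\<^sub>R y + t *\<^sub>R z) $ i $ j + (s *\<^sub>R y + t *\<^sub>R z) $ j $ i = 2 * f i j
          else 2 * f i j < (s *\<^sub>R y + t *\<^sub>R z) $ i $ j + (s *\<^sub>R y + t *\<^sub>R z) $ j $ i"
        proof (cases "{i, j} \<in> G")
          case True
          then have "?y = 2 * f i j" "?z = 2 * f i j" using yz ij by (auto simp: Q_def)
          then show ?thesis using True st unfolding e by (simp flip: distrib_right)
        next
          case False
          then have "2 * f i j < ?y" "2 * f i j < ?z" using yz ij by (auto simp: Q_def)
          then have "2 * f i j < s * ?y + t * ?z"
            using convex_bound_lt[of "- ?y" "- (2 * f i j)" "- ?z" s t] st by (simp only: neg_less_iff_less mult_minus_right minus_add_distrib[symmetric])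
          then show ?thesis using False unfolding e by simp
        qed
      qed
    qed
    moreover have F_in: "(\<chi> i j. f i j + (if {i, j} \<in> G then 0 else e)) \<in> Q" if "e > 0" for e
      using that f_sym by (auto simp: Q_def insert_commute)
    then have "Q \<noteq> {}" using zero_less_one by blast
    ultimately obtain w \<beta> where w: "w \<noteq> 0"
      and wL: "\<And>u. inner w (L u) \<le> \<beta>" and wQ: "\<And>z. z \<in> Q \<Longrightarrow> \<beta> \<le> inner w z"
      using separating_hyperplane_sets[OF _ _ _ _ disj] by fastforce
    \<comment> \<open>A linear functional bounded above on a subspace vanishes there.\<close>
    have L0: "inner w (L u) = 0" for u
    proof (rule ccontr)
      assume n: "inner w (L u) \<noteq> 0"
      have "inner w (L (\<lambda>i. ((\<beta> + 1) / inner w (L u)) *\<^sub>R u i + 0 *\<^sub>R u i)) \<le> \<beta>" by (rule wL)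
      then have "\<beta> + 1 \<le> \<beta>" using n unfolding linL by simp
      then show False by simp
    qed
    have \<beta>0: "0 \<le> \<beta>" using wL L0 by metis
    define z0 :: "real^'n^'n" where "z0 = (\<chi> i j. f i j + (if {i, j} \<in> G then 0 else 1))"
    have z0: "z0 \<in> Q" unfolding z0_def by (rule F_in) simp
    \<comment> \<open>\<open>w\<close> is nonnegative on every direction in which \<open>Q\<close>
      is unbounded. Suitable \<open>D\<close> give symmetry, zero diagonal and the signs off
      \<open>G\<close>.\<close>
    have ray: "0 \<le> inner w D" if D: "\<And>t. 0 \<le> t \<Longrightarrow> z0 + t *\<^sub>R D \<in> Q" for D
    proof (rule ccontr)
      assume n: "\<not> 0 \<le> inner w D"
      define t where "t = (inner w z0 + 1) / - inner w D"
      have "0 \<le> inner w z0" using wQ[OF z0] \<beta>0 by simp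
      then have "0 \<le> t" using n unfolding t_def by (intro divide_nonneg_pos) auto
      then have "0 \<le> inner w (z0 + t *\<^sub>R D)" using wQ[OF D] \<beta>0 by fastforce
      also have "\<dots> = inner w z0 + t * inner w D" by (simp add: inner_add_right)
      also have "t * inner w D = - (inner w z0 + 1)" using n by (auto simp: t_def)
      finally show False by simp
    qed
    define E :: "'n \<Rightarrow> 'n \<Rightarrow> real^'n^'n" where "E i j = axis i (axis j 1)" for i j
    have wE: "inner w (E i j) = w $ i $ j" for i j
      by (simp add: E_def inner_axis)
    have E_nth: "E i j $ k $ l = (if k = i \<and> l = j then 1 else 0)" for i j k l
      by (auto simp: E_def axis_def)
    have sym: "w $ i $ j = w $ j $ i" for i j
    proof -
      have "0 \<le> inner w (E k l - E l k)" for k l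
      proof (rule ray)
        fix t :: real
        show "z0 + t *\<^sub>R (E k l - E l k) \<in> Q"
          using z0 by (auto simp: Q_def E_nth)
      qed
      then have "w $ k $ l \<ge> w $ l $ k" for k l by (simp add: inner_diff_right wE)
      then show ?thesis by (meson order_antisym)
    qed
    have diag: "w $ i $ i = 0" for i
    proof -
      have Q': "z0 + t *\<^sub>R E i i \<in> Q" for t
        using z0 by (auto simp: Q_def E_nth)
      then have "0 \<le> inner w (E i i)" by (intro ray)
      moreover have "0 \<le> inner w (- E i i)"
        using Q'[of "- t" for t] by (intro ray) simp
      ultimately show ?thesis by (simp add: wE)
    qed
    have nonneg: "0 \<le> w $ i $ j" if "i \<noteq> j" "{i, j} \<notin> G" for i j
    proof -
      have "0 \<le> inner w (E i j)"
      proof (rule ray)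
        fix t :: real assume "0 \<le> t"
        show "z0 + t *\<^sub>R E i j \<in> Q"
          unfolding Q_def
        proof (intro CollectI allI impI)
          fix k l :: 'n assume kl: "k \<noteq> l"
          define m where "m = E i j $ k $ l + E i j $ l $ k"
          have e: "(z0 + t *\<^sub>R E i j) $ k $ l + (z0 + t *\<^sub>R E i j) $ l $ k
              = z0 $ k $ l + z0 $ l $ k + t * m"
            by (simp add: m_def algebra_simps)
          have m: "0 \<le> t * m" "{k, l} \<in> G \<Longrightarrow> m = 0"
            using that \<open>0 \<le> t\<close> by (auto simp: m_def E_nth insert_commute)
          show "if {k, l} \<in> G
            then (z0 + t *\<^sub>R E i j) $ k $ l + (z0 + t *\<^sub>R E i j) $ l $ k = 2 * f k l
            else 2 * f k l < (z0 + t *\<^sub>R E i j) $ k $ l + (z0 + t *\<^sub>R E i j) $ l $ k"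
          proof (cases "{k, l} \<in> G")
            case True
            then have "z0 $ k $ l + z0 $ l $ k = 2 * f k l" using z0 kl by (auto simp: Q_def)
            then show ?thesis unfolding e using True m(2) by simp
          next
            case False
            then have "2 * f k l < z0 $ k $ l + z0 $ l $ k" using z0 kl by (auto simp: Q_def)
            then show ?thesis unfolding e using False m(1) by simp
          qed
        qed
      qed
      then show ?thesis by (simp add: wE)
    qed
    \<comment> \<open>The matrix of \<open>f\<close> is a limit of points of \<open>Q\<close> as
      \<open>e\<close> tends to zero.\<close>
    have energy: "0 \<le> (\<Sum>i\<in>UNIV. \<Sum>j\<in>UNIV. w $ i $ j * f i j)"
    proof -
      define F :: "real^'n^'n" where "F = (\<chi> i j. f i j)"
      define N :: "real^'n^'n" where "N = (\<chi> i j. if {i, j} \<in> G then 0 else 1)"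
      have "0 \<le> inner w F + e * inner w N" if "e > 0" for e
      proof -
        have "(\<chi> i j. f i j + (if {i, j} \<in> G then 0 else e)) = F + e *\<^sub>R N"
          by (simp add: F_def N_def vec_eq_iff)
        then have "0 \<le> inner w (F + e *\<^sub>R N)" using wQ[OF F_in[OF that]] \<beta>0 by simp
        then show ?thesis by (simp add: inner_add_right)
      qed
      then have "\<forall>\<^sub>F e in at_right 0. 0 \<le> inner w F + e * inner w N"
        by (auto simp: eventually_at_right_field intro: exI[of _ 1])
      moreover have "((\<lambda>e. inner w F + e * inner w N) \<longlongrightarrow> inner w F + 0 * inner w N) (at_right 0)"
        by (intro tendsto_intros)
      ultimately have "0 \<le> inner w F"
        using tendsto_lowerbound trivial_limit_at_right_real by fastforce
      then show ?thesis by (simp add: inner_matrix F_def)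
    qed
    have equilibrium: "(\<Sum>j\<in>UNIV. w $ i $ j *\<^sub>R (p j - p i)) = 0" for i
    proof -
      \<comment> \<open>The test motion consists of the resultant forces themselves; the work of
        \<open>w\<close> on it is twice the sum of their squared lengths.\<close>
      define u where "u k = (\<Sum>j\<in>UNIV. w $ k $ j *\<^sub>R (p k - p j))" for k
      have A: "(\<Sum>k\<in>UNIV. \<Sum>l\<in>UNIV. w $ k $ l * inner (p k - p l) (u k)) = (\<Sum>k\<in>UNIV. inner (u k) (u k))"
      proof (rule sum.cong[OF refl])
        fix k
        have "inner (u k) (u k) = inner (\<Sum>l\<in>UNIV. w $ k $ l *\<^sub>R (p k - p l)) (u k)"
          by (simp only: u_def)
        then show "(\<Sum>l\<in>UNIV. w $ k $ l * inner (p k - p l) (u k)) = inner (u k) (u k)"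
          by (simp add: inner_sum_left)
      qed
      have B: "(\<Sum>k\<in>UNIV. \<Sum>l\<in>UNIV. w $ k $ l * inner (p k - p l) (u l))
          = - (\<Sum>k\<in>UNIV. \<Sum>l\<in>UNIV. w $ k $ l * inner (p k - p l) (u k))"
        unfolding sum_negf[symmetric]
        by (subst sum.swap, intro sum.cong refl, subst sym) (simp add: inner_diff_left algebra_simps)
      have "0 = inner w (L u)" by (simp add: L0)
      also have "\<dots> = (\<Sum>k\<in>UNIV. \<Sum>l\<in>UNIV. w $ k $ l * inner (p k - p l) (u k) - w $ k $ l * inner (p k - p l) (u l))"
        unfolding inner_matrix L_def by (intro sum.cong refl) (simp add: inner_diff_right algebra_simps)
      also have "\<dots> = 2 * (\<Sum>k\<in>UNIV. inner (u k) (u k))"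
        using A B by (simp add: sum_subtractf)
      finally have "(\<Sum>k\<in>UNIV. inner (u k) (u k)) = 0" by simp
      then have "inner (u i) (u i) = 0"
        by (simp add: sum_nonneg_eq_0_iff)
      then have "u i = 0" by simp
      moreover have "(\<Sum>j\<in>UNIV. w $ i $ j *\<^sub>R (p j - p i)) = - u i"
        unfolding u_def sum_negf[symmetric] by (intro sum.cong refl) (simp add: algebra_simps)
      ultimately show ?thesis by simp
    qed
    have "w $ i $ j = 0" for i j
    proof (cases "i = j")
      case False
      show ?thesis
        using stress_zero_if_energy_nonneg[where w = "\<lambda>i j. w $ i $ j" and p = p and G = G and a = a and b = b,
            OF gp G sym equilibrium nonneg _ False] energy
        unfolding f_def by blast
    qed (simp add: diag)
    then have "w = 0" by (simp add: vec_eq_iff)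
    then show False using w by simp
  qed
  then obtain u where u: "L u \<in> Q" by auto
  have sw: "inner (p j - p i) (u j - u i) = inner (p i - p j) (u i - u j)" for i j
    by (rule inner_swap_diff)
  show thesis
  proof (rule that)
    show "inner (p i - p j) (u i - u j) = f i j" if "i \<noteq> j" "{i, j} \<in> G" for i j
      using u that sw[of j i] unfolding Q_def L_def by fastforce
    show "f i j < inner (p i - p j) (u i - u j)" if "i \<noteq> j" "{i, j} \<notin> G" for i j
      using u that sw[of j i] unfolding Q_def L_def by fastforce
  qed
qed

section \<open>Independence of edges\<close>

lemma independent_family:
  fixes r :: "'i \<Rightarrow> 'a::real_vector"
  assumes fin: "finite I"
    and zero: "\<And>c i. (\<Sum>i\<in>I. c i *\<^sub>R r i) = 0 \<Longrightarrow> i \<in> I \<Longrightarrow> c i = 0"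
  shows "inj_on r I \<and> independent (r ` I)"
proof
  show inj: "inj_on r I"
  proof (rule inj_onI, rule ccontr)
    fix i j assume ij: "i \<in> I" "j \<in> I" "r i = r j" "i \<noteq> j"
    let ?c = "\<lambda>k. (if k = i then 1 else 0) - (if k = j then 1 else 0) :: real"
    have "(\<Sum>k\<in>I. ?c k *\<^sub>R r k) = (\<Sum>k\<in>I. (if k = i then r i else 0) - (if k = j then r j else 0))"
      by (intro sum.cong refl) auto
    also have "\<dots> = 0" using ij fin by (simp add: sum_subtractf)
    finally have "?c i = 0" using zero[of ?c i] ij by blast
    then show False using ij by simp
  qed
  show "independent (r ` I)"
  proof (rule independent_if_scalars_zero)
    show "finite (r ` I)" using fin by simp
    fix c x assume c: "(\<Sum>x\<in>r ` I. c x *\<^sub>R x) = 0" and x: "x \<in> r ` I"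
    then obtain i where i: "i \<in> I" "x = r i" by blast
    have "(\<Sum>i\<in>I. c (r i) *\<^sub>R r i) = 0" using c by (simp add: sum.reindex[OF inj])
    then show "c x = 0" using zero[of "\<lambda>i. c (r i)" i] i by simp
  qed
qed

lemma dim_orthogonal_independent_family:
  fixes r :: "'i \<Rightarrow> 'a::euclidean_space"
  assumes fin: "finite I"
    and zero: "\<And>c i. (\<Sum>i\<in>I. c i *\<^sub>R r i) = 0 \<Longrightarrow> i \<in> I \<Longrightarrow> c i = 0"
  shows "dim {y. \<forall>i\<in>I. inner (r i) y = 0} + card I = DIM('a)"
proof -
  have ind: "inj_on r I" "independent (r ` I)" using independent_family[of I r] assms by auto
  have "dim {y \<in> UNIV. \<forall>x\<in>span (r ` I). orthogonal x y} + dim (span (r ` I)) = dim (UNIV::'a set)"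
    by (rule dim_subspace_orthogonal_to_vectors) auto
  moreover have "dim (span (r ` I)) = card I"
    using dim_span_eq_card_independent[OF ind(2)] card_image[OF ind(1)] by simp
  moreover have "{y \<in> UNIV. \<forall>x\<in>span (r ` I). orthogonal x y} = {y. \<forall>i\<in>I. inner (r i) y = 0}"
  proof -
    have "orthogonal x y" if "\<forall>i\<in>I. inner (r i) y = 0" "x \<in> span (r ` I)" for x y
    proof -
      have "orthogonal y x"
        by (rule orthogonal_to_span[OF that(2)]) (use that(1) in \<open>auto simp: orthogonal_def inner_commute\<close>)
      then show ?thesis by (simp add: orthogonal_commute)
    qed
    then show ?thesis by (auto simp: orthogonal_def span_base)
  qed
  ultimately show ?thesis by simp
qed

section \<open>Rigidity rows, normalization and tight graphs\<close>

locale expansion_polyhedron =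
  fixes p :: "'n::finite \<Rightarrow> complex" and i1 i2 :: 'n and a b :: complex
  assumes gp: "general_position p" and Im_ne: "Im (p i1) \<noteq> Im (p i2)"
begin

definition f :: "'n \<Rightarrow> 'n \<Rightarrow> real" where
  "f = (\<lambda>i j. det3 a (p i) (p j) * det3 b (p i) (p j))"

text \<open>For an edge \<open>e = {i, j}\<close> the nonzero entries are \<open>p i - p j\<close> at \<open>i\<close> and \<open>p j - p i\<close> at \<open>j\<close>.\<close>
definition edge_vector :: "'n set \<Rightarrow> complex^'n" where
  "edge_vector e = (\<chi> k. if k \<in> e then 2 * p k - (\<Sum>m\<in>e. p m) else 0)"

definition normal_vector :: "nat \<Rightarrow> complex^'n" where
  "normal_vector k = (if k = 0 then axis i1 1 else if k = 1 then axis i1 \<i> else axis i2 1)"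

text \<open>Rigidity rows and normalization rows form one family, so that a single independence
  statement covers both.\<close>

definition row :: "'n set + nat \<Rightarrow> complex^'n" where
  "row = case_sum edge_vector normal_vector"

lemma edge_vector_nth:
  assumes "k \<noteq> j"
  shows "edge_vector {k, j} $ k = p k - p j"
  using assms by (simp add: edge_vector_def)

lemma inner_edge_vector:
  assumes "i \<noteq> j"
  shows "inner (edge_vector {i, j}) v = inner (p i - p j) (v $ i - v $ j)"
proof -
  have "inner (edge_vector {i, j}) v = (\<Sum>k\<in>{i, j}. inner (edge_vector {i, j} $ k) (v $ k))"
    unfolding inner_vec_def by (intro sum.mono_neutral_right) (auto simp: edge_vector_def)
  also have "\<dots> = inner (p i - p j) (v $ i) + inner (p j - p i) (v $ j)"
    using assms by (simp add: edge_vector_def)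
  finally show ?thesis by (simp add: inner_diff_left inner_diff_right)
qed

lemma inner_normal_vector:
  "inner (normal_vector 0) v = Re (v $ i1)"
  "inner (normal_vector 1) v = Im (v $ i1)"
  "inner (normal_vector 2) v = Re (v $ i2)"
  by (simp_all add: normal_vector_def inner_axis' inner_complex_def)

lemma f_sym: "f i j = f j i"
  unfolding f_def det3_swap[of _ "p i" "p j"] by simp

abbreviation X :: "(complex^'n) set" where
  "X \<equiv> Xbar p i1 i2 f"

abbreviation E :: "complex^'n \<Rightarrow> 'n set set" where
  "E v \<equiv> tight_pairs p f {v}"

lemma mem_tight_pairs:
  "{i, j} \<in> tight_pairs p f K \<longleftrightarrow>
     i \<noteq> j \<and> (\<forall>v\<in>K. inner (p i - p j) (v $ i - v $ j) = f i j)"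
proof -
  have "inner (p j - p i) (v $ j - v $ i) = inner (p i - p j) (v $ i - v $ j)" for v :: "complex^'n" and i j
    by (rule inner_swap_diff)
  then show ?thesis
    unfolding tight_pairs_def using f_sym[of i j] by (auto simp: doubleton_eq_iff) (metis f_sym)+
qed

lemma is_graph_tight_pairs: "is_graph (tight_pairs p f K)"
  by (auto simp: is_graph_def tight_pairs_def)

lemma graph_subset_tight_pairs:
  assumes "is_graph G"
  shows "G \<subseteq> tight_pairs p f K \<longleftrightarrow> (\<forall>v\<in>K. G \<subseteq> E v)"
proof -
  have "e \<in> tight_pairs p f K \<longleftrightarrow> (\<forall>v\<in>K. e \<in> E v)" if "e \<in> G" for e
    using assms that mem_tight_pairs unfolding is_graph_def by (metis singleton_iff)
  then show ?thesis by blast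
qed

lemma mem_X:
  "v \<in> X \<longleftrightarrow> (\<forall>k<3. inner (normal_vector k) v = 0) \<and>
     (\<forall>i j. i \<noteq> j \<longrightarrow> f i j \<le> inner (edge_vector {i, j}) v)"
proof -
  have "(\<forall>k<3. inner (normal_vector k) v = 0) \<longleftrightarrow> Re (v $ i1) = 0 \<and> Im (v $ i1) = 0 \<and> Re (v $ i2) = 0"
    unfolding inner_normal_vector[symmetric]
    by (auto simp: numeral_3_eq_3 less_Suc_eq numeral_2_eq_2)
  then show ?thesis by (auto simp: Xbar_def inner_edge_vector)
qed

lemma tight_graph_pointed_noncrossing:
  assumes "v \<in> X"
  shows "E v \<in> pointed_noncrossing_graphs p"
proof -
  interpret expansive_motion p "\<lambda>k. v $ k" a b
    using gp assms by unfold_locales (auto simp: Xbar_def f_def)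
  have "E v = {{i, j} |i j. tight i j}"
    by (auto simp: tight_pairs_def tight_def f_def)
  then show ?thesis using tight_graph_pointed_noncrossing by simp
qed

text \<open>Rigid motions leave all strains unchanged, so a translation and an infinitesimal
  rotation about \<open>p i1\<close> bring the motion into normalized form.\<close>

lemma exists_point_with_tight_graph:
  assumes G: "G \<in> pointed_noncrossing_graphs p"
  obtains v where "v \<in> X" "E v = G"
proof -
  obtain u where u:
    "\<And>i j. i \<noteq> j \<Longrightarrow> {i, j} \<in> G \<Longrightarrow> inner (p i - p j) (u i - u j) = f i j"
    "\<And>i j. i \<noteq> j \<Longrightarrow> {i, j} \<notin> G \<Longrightarrow> f i j < inner (p i - p j) (u i - u j)"
    using exists_motion_with_tight_graph[OF gp G, of a b] unfolding f_def by metis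
  \<comment> \<open>The rotation rate that cancels the horizontal velocity of \<open>i2\<close>; the
    denominator is nonzero by \<open>Im_ne\<close>.\<close>
  define c where "c = Re (u i2 - u i1) / (Im (p i1) - Im (p i2))"
  define v :: "complex^'n" where "v = (\<chi> k. u k - u i1 - c *\<^sub>R (\<i> * (p k - p i1)))"
  have len: "inner (p i - p j) (v $ i - v $ j) = inner (p i - p j) (u i - u j)" for i j
    by (simp add: v_def inner_complex_def algebra_simps)
  have "Re (v $ i2) = 0"
    using Im_ne by (simp add: v_def c_def field_simps)
  then have "v \<in> X"
    using u by (auto simp: Xbar_def len) (auto simp: v_def intro: order_less_imp_le order_eq_refl, metis order.refl order_less_imp_le)
  moreover have "E v = G"
  proof -
    have "{i, j} \<in> E v \<longleftrightarrow> {i, j} \<in> G" if "i \<noteq> j" for i j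
      using u(1)[OF that] u(2)[OF that] that by (cases "{i, j} \<in> G") (auto simp: mem_tight_pairs len)
    moreover have "is_graph G" using G by (simp add: pointed_noncrossing_graphs_def)
    ultimately show ?thesis
      using is_graph_tight_pairs[of "{v}"] unfolding is_graph_def by (metis subsetI subset_antisym)
  qed
  ultimately show thesis by (rule that)
qed

text \<open>Testing a dependency on rigid motions removes the normalization rows. What remains is a
  self-stress supported on \<open>G\<close>; it or its negative has nonnegative energy, so it
  vanishes.\<close>

lemma rows_independent:
  assumes G: "G \<in> pointed_noncrossing_graphs p"
    and sum0: "(\<Sum>s\<in>G <+> {..<3}. c s *\<^sub>R row s) = 0" and s: "s \<in> G <+> {..<3}"
  shows "c s = 0"
proof -
  have graph: "\<exists>i j. i \<noteq> j \<and> e = {i, j}" if "e \<in> G" for e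
    using G that by (auto simp: pointed_noncrossing_graphs_def is_graph_def)
  define \<beta> where "\<beta> k = c (Inr k)" for k
  have split: "(\<Sum>e\<in>G. c (Inl e) *\<^sub>R edge_vector e) + (\<Sum>k<3. \<beta> k *\<^sub>R normal_vector k) = 0"
    using sum0 by (subst (asm) sum.Plus) (auto simp: row_def \<beta>_def)
  have three: "{..<3::nat} = {0, 1, 2}" by auto
  \<comment> \<open>Rigid motions are orthogonal to all edge vectors, so they only see the normalization.\<close>
  have rigid: "\<beta> 0 * Re (v $ i1) + \<beta> 1 * Im (v $ i1) + \<beta> 2 * Re (v $ i2) = 0"
    if "\<And>i j. inner (p i - p j) (v $ i - v $ j) = 0" for v
  proof -
    have "inner (edge_vector e) v = 0" if "e \<in> G" for e
      using graph[OF that] \<open>\<And>i j. inner (p i - p j) (v $ i - v $ j) = 0\<close> by (auto simp: inner_edge_vector)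
    moreover have "0 = inner ((\<Sum>e\<in>G. c (Inl e) *\<^sub>R edge_vector e) + (\<Sum>k<3. \<beta> k *\<^sub>R normal_vector k)) v"
      by (simp add: split)
    ultimately have "0 = (\<Sum>k<3. \<beta> k * inner (normal_vector k) v)"
      by (simp add: inner_add_left inner_sum_left)
    then show ?thesis using inner_normal_vector[of v] unfolding three by simp
  qed
  \<comment> \<open>The test motions are the vertical translation, the rotation about
    \<open>p i1\<close> and the horizontal translation.\<close>
  have "\<beta> 1 = 0" using rigid[of "\<chi> k. \<i>"] by simp
  moreover have "\<beta> 2 = 0"
    using rigid[of "\<chi> k. \<i> * (p k - p i1)"] Im_ne by (simp add: inner_complex_def algebra_simps)
  moreover have "\<beta> 0 + \<beta> 2 = 0" using rigid[of "\<chi> k. 1"] by simp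
  ultimately have \<beta>: "\<beta> k = 0" if "k < 3" for k
    using that by (auto simp: numeral_3_eq_3 less_Suc_eq numeral_2_eq_2)
  define w where "w i j = (if i \<noteq> j \<and> {i, j} \<in> G then c (Inl {i, j}) else 0)" for i j
  have sym: "w i j = w j i" for i j by (auto simp: w_def insert_commute)
  have equilibrium: "(\<Sum>j\<in>UNIV. w k j *\<^sub>R (p j - p k)) = 0" for k
  proof -
    have "0 = - (\<Sum>e\<in>G. c (Inl e) *\<^sub>R edge_vector e) $ k"
      using split \<beta> by simp
    also have "\<dots> = - (\<Sum>e\<in>G. c (Inl e) *\<^sub>R (edge_vector e $ k))"
      by (simp add: sum_component)
    also have "(\<Sum>e\<in>G. c (Inl e) *\<^sub>R (edge_vector e $ k)) = (\<Sum>e\<in>{e\<in>G. k \<in> e}. c (Inl e) *\<^sub>R (edge_vector e $ k))"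
      by (intro sum.mono_neutral_right) (auto simp: edge_vector_def)
    also have "\<dots> = (\<Sum>j\<in>{j. j \<noteq> k \<and> {k, j} \<in> G}. c (Inl {k, j}) *\<^sub>R (edge_vector {k, j} $ k))"
    proof (rule sum.reindex_bij_betw[symmetric])
      show "bij_betw (\<lambda>j. {k, j}) {j. j \<noteq> k \<and> {k, j} \<in> G} {e \<in> G. k \<in> e}"
        unfolding bij_betw_def
      proof
        show "inj_on (\<lambda>j. {k, j}) {j. j \<noteq> k \<and> {k, j} \<in> G}"
          by (auto simp: inj_on_def doubleton_eq_iff)
        show "(\<lambda>j. {k, j}) ` {j. j \<noteq> k \<and> {k, j} \<in> G} = {e \<in> G. k \<in> e}"
        proof (intro equalityI subsetI)
          fix e assume e: "e \<in> {e \<in> G. k \<in> e}"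
          then obtain i j where "i \<noteq> j" "e = {i, j}" using graph by blast
          then have "\<exists>l. l \<noteq> k \<and> e = {k, l}" using e by (cases "i = k") (auto simp: insert_commute)
          then obtain l where "l \<noteq> k" "e = {k, l}" by blast
          then show "e \<in> (\<lambda>j. {k, j}) ` {j. j \<noteq> k \<and> {k, j} \<in> G}" using e by auto
        qed auto
      qed
    qed
    also have "- \<dots> = (\<Sum>j\<in>{j. j \<noteq> k \<and> {k, j} \<in> G}. w k j *\<^sub>R (p j - p k))"
      unfolding sum_negf[symmetric]
      by (intro sum.cong refl) (auto simp: w_def edge_vector_nth algebra_simps)
    also have "\<dots> = (\<Sum>j\<in>UNIV. w k j *\<^sub>R (p j - p k))"
      by (intro sum.mono_neutral_left) (auto simp: w_def)
    finally show ?thesis by simp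
  qed
  let ?en = "\<lambda>w. \<Sum>i\<in>UNIV. \<Sum>j\<in>UNIV. w i j * (det3 a (p i) (p j) * det3 b (p i) (p j))"
  have w0: "w i j = 0" if "i \<noteq> j" for i j
  proof (cases "0 \<le> ?en w")
    case True
    show ?thesis
      by (rule stress_zero_if_energy_nonneg[OF gp G sym equilibrium _ True that]) (simp add: w_def)
  next
    case False
    have "- w i j = 0"
    proof (rule stress_zero_if_energy_nonneg[OF gp G _ _ _ _ that])
      show "- w i j = - w j i" for i j using sym by simp
      show "(\<Sum>j\<in>UNIV. - w i j *\<^sub>R (p j - p i)) = 0" for i
        using equilibrium[of i] by (simp add: sum_negf)
      show "0 \<le> - w i j" if "{i, j} \<notin> G" for i j using that by (simp add: w_def)
      show "0 \<le> ?en (\<lambda>i j. - w i j)" using False by (simp add: sum_negf)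
    qed
    then show ?thesis by simp
  qed
  show ?thesis
  proof (cases s)
    case (Inl e)
    then have e: "e \<in> G" using s by auto
    then obtain i j where "i \<noteq> j" "e = {i, j}" using graph by blast
    then show ?thesis using w0[of i j] Inl e by (simp add: w_def)
  next
    case (Inr k)
    then show ?thesis using s \<beta>[of k] by (auto simp: \<beta>_def)
  qed
qed

end

section \<open>Faces of the polyhedron\<close>

context expansion_polyhedron
begin

lemma convex_X: "convex X"
proof (rule convexI)
  fix v u and s t :: real
  assume vu: "v \<in> X" "u \<in> X" and st: "0 \<le> s" "0 \<le> t" "s + t = 1"
  have "f i j \<le> s * inner (edge_vector {i, j}) v + t * inner (edge_vector {i, j}) u" if "i \<noteq> j" for i j
  proof -
    have "f i j = s * f i j + t * f i j" using st by (simp flip: distrib_right)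
    also have "\<dots> \<le> s * inner (edge_vector {i, j}) v + t * inner (edge_vector {i, j}) u"
      using vu st that by (intro add_mono mult_left_mono) (auto simp: mem_X)
    finally show ?thesis .
  qed
  then show "s *\<^sub>R v + t *\<^sub>R u \<in> X"
    using vu by (simp add: mem_X inner_add_right)
qed

lemma polyhedron_X: "polyhedron X"
proof -
  have "X = (\<Inter>k\<in>{..<3}. {v. inner (normal_vector k) v = 0}) \<inter>
     (\<Inter>(i, j)\<in>{(i, j). i \<noteq> j}. {v. inner (edge_vector {i, j}) v \<ge> f i j})"
    by (auto simp: mem_X)
  also have "polyhedron \<dots>"
    by (intro polyhedron_Int polyhedron_Inter)
      (auto intro: polyhedron_hyperplane polyhedron_halfspace_ge)
  finally show ?thesis .
qed

text \<open>Candidate inverse of \<open>tight_pairs\<close>; further pairs may be tight at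
  individual points.\<close>

definition face :: "'n set set \<Rightarrow> (complex^'n) set" where
  "face G = {v \<in> X. G \<subseteq> E v}"

lemma graph_subset_E:
  assumes "is_graph G"
  shows "G \<subseteq> E v \<longleftrightarrow> (\<forall>i j. {i, j} \<in> G \<longrightarrow> i \<noteq> j \<and> inner (edge_vector {i, j}) v = f i j)"
proof -
  have "G \<subseteq> E v \<longleftrightarrow> (\<forall>i j. {i, j} \<in> G \<longrightarrow> {i, j} \<in> E v)"
  proof (intro iffI allI impI subsetI)
    fix e assume *: "\<forall>i j. {i, j} \<in> G \<longrightarrow> {i, j} \<in> E v" and e: "e \<in> G"
    obtain i j where "e = {i, j}" using assms e unfolding is_graph_def by metis
    then show "e \<in> E v" using * e by simp
  qed blast
  also have "\<dots> \<longleftrightarrow> (\<forall>i j. {i, j} \<in> G \<longrightarrow> i \<noteq> j \<and> inner (edge_vector {i, j}) v = f i j)"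
    by (simp add: mem_tight_pairs inner_edge_vector cong: conj_cong)
  finally show ?thesis .
qed

lemma graph_edge_ne:
  assumes "is_graph G" "{i, j} \<in> G"
  shows "i \<noteq> j"
proof -
  have "\<exists>k l. k \<noteq> l \<and> {i, j} = {k, l}"
    using assms unfolding is_graph_def by (rule bspec)
  then show ?thesis by (auto simp: doubleton_eq_iff)
qed

text \<open>A combination of two nonnegative gaps with positive weights is zero only if both gaps
  are.\<close>

lemma face_face_of:
  assumes "is_graph G"
  shows "face G face_of X"
  unfolding face_of_def
proof (intro conjI ballI impI)
  show "face G \<subseteq> X" by (auto simp: face_def)
  show "convex (face G)"
  proof (rule convexI)
    fix v u and s t :: real
    assume vu: "v \<in> face G" "u \<in> face G" and st: "0 \<le> s" "0 \<le> t" "s + t = 1"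
    have "s * f i j + t * f i j = f i j" for i j using st by (simp flip: distrib_right)
    moreover have "s *\<^sub>R v + t *\<^sub>R u \<in> X" using convexD[OF convex_X] vu st by (simp add: face_def)
    ultimately show "s *\<^sub>R v + t *\<^sub>R u \<in> face G"
      using vu by (simp add: face_def graph_subset_E[OF assms] inner_add_right)
  qed
  fix u v w assume u: "u \<in> X" and v: "v \<in> X" and w: "w \<in> face G" "w \<in> open_segment u v"
  then obtain t where t: "0 < t" "t < 1" "w = (1 - t) *\<^sub>R u + t *\<^sub>R v"
    by (auto simp: in_segment)
  have both: "inner (edge_vector {i, j}) u = f i j \<and> inner (edge_vector {i, j}) v = f i j"
    if "{i, j} \<in> G" for i j
  proof -
    have ij: "i \<noteq> j" using graph_edge_ne[OF assms that] .
    let ?u = "inner (edge_vector {i, j}) u - f i j" and ?v = "inner (edge_vector {i, j}) v - f i j"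
    have nn: "0 \<le> ?u" "0 \<le> ?v" using u v ij by (auto simp: mem_X)
    have "inner (edge_vector {i, j}) w = f i j"
      using w(1) that by (auto simp: face_def graph_subset_E[OF assms])
    then have "(1 - t) * ?u + t * ?v = 0"
      unfolding t(3) by (simp add: inner_add_right algebra_simps)
    moreover have "0 \<le> (1 - t) * ?u" "0 \<le> t * ?v" using nn t by auto
    ultimately have "(1 - t) * ?u = 0" "t * ?v = 0" by linarith+
    then show ?thesis using t by simp
  qed
  show "u \<in> face G" "v \<in> face G"
    using u v both graph_edge_ne[OF assms] by (auto simp: face_def graph_subset_E[OF assms])
qed

text \<open>At a relative interior point \<open>v\<close> only the pairs tight on all of
  \<open>K\<close> are tight, since segments of \<open>K\<close> can be prolonged past
  \<open>v\<close>. Conversely, from any \<open>u\<close> where these pairs are tight one can go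
  slightly beyond \<open>v\<close> within \<open>X\<close>, so the face property puts
  \<open>u\<close> into \<open>K\<close>.\<close>

lemma nonempty_face:
  assumes K: "K face_of X" "K \<noteq> {}"
  obtains v where "v \<in> K" "tight_pairs p f K = E v" "K = face (tight_pairs p f K)"
proof -
  have convK: "convex K" and KX: "K \<subseteq> X" using K(1) by (auto simp: face_of_def)
  obtain v where v: "v \<in> rel_interior K"
    using rel_interior_eq_empty[OF convK] K(2) by blast
  then have vK: "v \<in> K" using rel_interior_subset by blast
  have "inner (edge_vector {i, j}) u = f i j"
    if "u \<in> K" "i \<noteq> j" "inner (edge_vector {i, j}) v = f i j" for u i j
  proof -
    obtain e where e: "e > 1" "(1 - e) *\<^sub>R u + e *\<^sub>R v \<in> K"
      using v \<open>u \<in> K\<close> convex_rel_interior_iff[OF convK K(2)] by blast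
    have "f i j \<le> inner (edge_vector {i, j}) ((1 - e) *\<^sub>R u + e *\<^sub>R v)"
      using e(2) KX that(2) by (auto simp: mem_X)
    also have "\<dots> = (1 - e) * inner (edge_vector {i, j}) u + e * f i j"
      by (simp add: inner_add_right that(3))
    finally have "(e - 1) * (inner (edge_vector {i, j}) u - f i j) \<le> 0"
      by (simp add: algebra_simps)
    then have "inner (edge_vector {i, j}) u - f i j \<le> 0"
      using e(1) by (simp add: mult_le_0_iff)
    moreover have "f i j \<le> inner (edge_vector {i, j}) u"
      using that KX by (auto simp: mem_X)
    ultimately show ?thesis by simp
  qed
  then have tight: "{i, j} \<in> E v \<Longrightarrow> {i, j} \<in> tight_pairs p f K" for i j
    by (auto simp: mem_tight_pairs inner_edge_vector)
  have "E v \<subseteq> tight_pairs p f K"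
  proof
    fix e assume e: "e \<in> E v"
    then obtain i j where "e = {i, j}" using is_graph_tight_pairs[of "{v}"] by (auto simp: is_graph_def)
    then show "e \<in> tight_pairs p f K" using tight e by blast
  qed
  moreover have "tight_pairs p f K \<subseteq> E v" using vK by (auto simp: tight_pairs_def)
  ultimately have EK: "tight_pairs p f K = E v" by blast
  have "face (E v) \<subseteq> K"
  proof
    fix u assume u: "u \<in> face (E v)"
    show "u \<in> K"
    proof (cases "u = v")
      case False
      have uX: "u \<in> X" using u by (simp add: face_def)
      have vX: "v \<in> X" using vK KX by blast
      have "\<forall>\<^sub>F t in at_right (0::real). \<forall>ij\<in>UNIV. fst ij \<noteq> snd ij \<longrightarrow>
         f (fst ij) (snd ij) \<le> inner (edge_vector {fst ij, snd ij}) (v + t *\<^sub>R (v - u))"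
      proof (intro eventually_ball_finite ballI)
        fix ij :: "'n \<times> 'n"
        obtain i j where ij: "ij = (i, j)" by (cases ij)
        show "\<forall>\<^sub>F t in at_right 0. fst ij \<noteq> snd ij \<longrightarrow>
         f (fst ij) (snd ij) \<le> inner (edge_vector {fst ij, snd ij}) (v + t *\<^sub>R (v - u))"
        proof (cases "i \<noteq> j \<and> {i, j} \<notin> E v")
          case True
          then have "f i j < inner (edge_vector {i, j}) v"
            using vX by (auto simp: mem_X mem_tight_pairs inner_edge_vector order_less_le)
          moreover have "((\<lambda>t. inner (edge_vector {i, j}) (v + t *\<^sub>R (v - u))) \<longlongrightarrow>
             inner (edge_vector {i, j}) (v + 0 *\<^sub>R (v - u))) (at_right 0)"
            by (intro tendsto_intros)
          ultimately have "\<forall>\<^sub>F t in at_right 0. f i j < inner (edge_vector {i, j}) (v + t *\<^sub>R (v - u))"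
            by (intro order_tendstoD(1)) auto
          then show ?thesis by eventually_elim (simp add: ij)
        next
          case False
          have "inner (edge_vector {i, j}) u = f i j" "inner (edge_vector {i, j}) v = f i j" if "i \<noteq> j"
            using False that u by (auto simp: face_def graph_subset_E[OF is_graph_tight_pairs]
                mem_tight_pairs inner_edge_vector)
          then show ?thesis by (simp add: ij inner_add_right inner_diff_right)
        qed
      qed simp
      moreover have "\<forall>\<^sub>F t in at_right 0. (0::real) < t" by (rule eventually_at_right_less)
      ultimately have "\<forall>\<^sub>F t in at_right 0. 0 < t \<and> v + t *\<^sub>R (v - u) \<in> X"
      proof eventually_elim
        case (elim t)
        then show ?case
          using vX uX by (auto simp: mem_X inner_add_right inner_diff_right)
      qed
      then obtain t where t: "0 < t" "v + t *\<^sub>R (v - u) \<in> X"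
        using eventually_happens'[OF trivial_limit_at_right_real] by blast
      \<comment> \<open>With this weight \<open>v\<close> is a convex combination of
        \<open>u\<close> and the point beyond \<open>v\<close>.\<close>
      define s where "s = 1 / (1 + t)"
      have s: "0 < s" "s < 1" "s * (1 + t) = 1" using t(1) by (auto simp: s_def)
      have "(1 - s) *\<^sub>R u + s *\<^sub>R (v + t *\<^sub>R (v - u)) = (s * (1 + t)) *\<^sub>R v + (1 - s * (1 + t)) *\<^sub>R u"
        by (simp add: algebra_simps)
      then have "v = (1 - s) *\<^sub>R u + s *\<^sub>R (v + t *\<^sub>R (v - u))" using s by simp
      moreover have "u \<noteq> v + t *\<^sub>R (v - u)"
      proof
        assume "u = v + t *\<^sub>R (v - u)"
        then have "(1 + t) *\<^sub>R (v - u) = 0" by (simp add: algebra_simps)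
        then show False using False t(1) by simp
      qed
      ultimately have "v \<in> open_segment u (v + t *\<^sub>R (v - u))"
        using s by (auto simp: in_segment)
      then show ?thesis using K(1) uX t(2) vK unfolding face_of_def by blast
    qed (use vK in simp)
  qed
  moreover have "K \<subseteq> face (tight_pairs p f K)"
    using KX by (auto simp: face_def tight_pairs_def)
  ultimately show thesis using that[OF vK EK] EK by auto
qed

text \<open>Near a point where exactly \<open>G\<close> is tight all other inequalities are strict,
  so the face agrees there with the affine space of \<open>card G + 3\<close> independent equations
  in real dimension \<open>2 * CARD('n)\<close>.\<close>

lemma aff_dim_face:
  assumes G: "G \<in> pointed_noncrossing_graphs p"
  shows "aff_dim (face G) = 2 * int CARD('n) - 3 - int (card G)"
proof -
  have graph: "is_graph G" using G by (simp add: pointed_noncrossing_graphs_def)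
  obtain v where v: "v \<in> X" "E v = G" using exists_point_with_tight_graph[OF G] .
  let ?I = "G <+> {..<3::nat}"
  define N where "N = {y. \<forall>s\<in>?I. inner (row s) y = 0}"
  have "dim N + card ?I = DIM(complex^'n)"
    unfolding N_def
    by (rule dim_orthogonal_independent_family) (auto dest: rows_independent[OF G])
  then have dimN: "int (dim N) = 2 * int CARD('n) - 3 - int (card G)"
    by (simp add: card_Plus)
  have "subspace N" by (auto simp: N_def subspace_def inner_add_right)
  define A where "A = (+) v ` N"
  have A: "aff_dim A = int (dim N)" "affine A"
    using \<open>subspace N\<close> affine_translation[of N v]
    by (auto simp: A_def aff_dim_translation_eq aff_dim_subspace subspace_imp_affine)
  \<comment> \<open>\<open>U\<close> keeps the remaining inequalities strict, so
    \<open>A \<inter> U\<close> is a relatively open part of \<open>A\<close> inside the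
    face.\<close>
  define U where "U = (\<Inter>(i, j)\<in>{(i, j). i \<noteq> j \<and> {i, j} \<notin> G}. {u. f i j < inner (edge_vector {i, j}) u})"
  have "open U" unfolding U_def by (intro open_INT) (auto intro: open_halfspace_gt)
  have "v \<in> A" unfolding A_def using \<open>subspace N\<close> by (force simp: subspace_0)
  moreover have "v \<in> U" using v by (auto simp: U_def mem_X mem_tight_pairs inner_edge_vector order_less_le)
  ultimately have "A \<inter> U \<noteq> {}" by blast
  have mem_A: "u \<in> A \<longleftrightarrow> (\<forall>e\<in>G. inner (edge_vector e) u = inner (edge_vector e) v) \<and>
      (\<forall>k<3. inner (normal_vector k) u = inner (normal_vector k) v)" for u
  proof -
    have "u \<in> A \<longleftrightarrow> u - v \<in> N" unfolding A_def by (force simp: image_iff)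
    also have "\<dots> \<longleftrightarrow> (\<forall>e\<in>G. inner (row (Inl e)) (u - v) = 0) \<and> (\<forall>k<3. inner (row (Inr k)) (u - v) = 0)"
      unfolding N_def by auto
    finally show ?thesis by (simp add: row_def inner_diff_right)
  qed
  have vG: "inner (edge_vector {i, j}) v = f i j" if "{i, j} \<in> G" for i j
  proof -
    have "{i, j} \<in> E v" using v that by blast
    then show ?thesis by (auto simp: mem_tight_pairs inner_edge_vector)
  qed
  have normal: "inner (normal_vector k) v = 0" if "k < 3" for k using v that by (simp add: mem_X)
  have "A \<inter> U \<subseteq> face G"
  proof
    fix u assume u: "u \<in> A \<inter> U"
    have uG: "inner (edge_vector {i, j}) u = f i j" if "{i, j} \<in> G" for i j
      using u vG[OF that] that by (auto simp: mem_A)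
    have "f i j \<le> inner (edge_vector {i, j}) u" if "i \<noteq> j" for i j
      using uG[of i j] u that by (cases "{i, j} \<in> G") (auto simp: U_def intro: order_less_imp_le)
    then have "u \<in> X" using u normal by (auto simp: mem_X mem_A)
    then show "u \<in> face G"
      using uG graph_edge_ne[OF graph] by (auto simp: face_def graph_subset_E[OF graph])
  qed
  moreover have "face G \<subseteq> A"
  proof
    fix u assume u: "u \<in> face G"
    have "inner (edge_vector e) u = inner (edge_vector e) v" if e: "e \<in> G" for e
    proof -
      obtain i j where "e = {i, j}" using e graph unfolding is_graph_def by metis
      then show ?thesis using u vG[of i j] e by (simp add: face_def graph_subset_E[OF graph])
    qed
    then show "u \<in> A" using u normal by (auto simp: mem_A face_def mem_X)
  qed
  moreover have "aff_dim (A \<inter> U) = aff_dim A"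
    using affine_hull_affine_Int_open[OF A(2) \<open>open U\<close> \<open>A \<inter> U \<noteq> {}\<close>] by (metis aff_dim_affine_hull)
  ultimately have "aff_dim (face G) = aff_dim A"
    by (metis aff_dim_subset order_antisym)
  then show ?thesis using A dimN by simp
qed

lemma tight_pairs_face:
  assumes G: "G \<in> pointed_noncrossing_graphs p"
  shows "tight_pairs p f (face G) = G" "face G \<noteq> {}"
proof -
  have graph: "is_graph G" using G by (simp add: pointed_noncrossing_graphs_def)
  obtain v where v: "v \<in> X" "E v = G" using exists_point_with_tight_graph[OF G] .
  then have "v \<in> face G" by (simp add: face_def)
  then show "face G \<noteq> {}" by blast
  have "tight_pairs p f (face G) \<subseteq> E v" using \<open>v \<in> face G\<close> by (auto simp: tight_pairs_def)
  moreover have "G \<subseteq> tight_pairs p f (face G)"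
    by (rule graph_subset_tight_pairs[OF graph, THEN iffD2]) (simp add: face_def)
  ultimately show "tight_pairs p f (face G) = G" using v by simp
qed

lemma tight_pairs_pointed_noncrossing:
  assumes "K face_of X" "K \<noteq> {}"
  shows "tight_pairs p f K \<in> pointed_noncrossing_graphs p"
proof -
  obtain v where v: "v \<in> K" "tight_pairs p f K = E v"
    using nonempty_face[OF assms] .
  then have "v \<in> X" using face_of_imp_subset[OF assms(1)] by blast
  then show ?thesis unfolding v(2) by (rule tight_graph_pointed_noncrossing)
qed

lemma face_tight_pairs:
  assumes "K face_of X" "K \<noteq> {}"
  shows "face (tight_pairs p f K) = K"
proof -
  obtain v where "K = face (tight_pairs p f K)"
    using nonempty_face[OF assms] .
  then show ?thesis by (rule sym)
qed

section \<open>Validity of the choice, dimension and simplicity\<close>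

lemma valid_choice: "valid_choice p i1 i2 f"
  unfolding valid_choice_def Let_def
proof
  let ?Fs = "{K. K face_of X \<and> K \<noteq> {}}"
  show "bij_betw (tight_pairs p f) ?Fs (pointed_noncrossing_graphs p)"
  proof (rule bij_betw_byWitness[where f' = face])
    show "\<forall>K\<in>?Fs. face (tight_pairs p f K) = K" using face_tight_pairs by blast
    show "\<forall>G\<in>pointed_noncrossing_graphs p. tight_pairs p f (face G) = G" using tight_pairs_face by blast
    show "tight_pairs p f ` ?Fs \<subseteq> pointed_noncrossing_graphs p" using tight_pairs_pointed_noncrossing by blast
    show "face ` pointed_noncrossing_graphs p \<subseteq> ?Fs"
      using tight_pairs_face(2) face_face_of by (auto simp: pointed_noncrossing_graphs_def)
  qed
  show "\<forall>K1\<in>?Fs. \<forall>K2\<in>?Fs. (K1 \<subseteq> K2) = (tight_pairs p f K2 \<subseteq> tight_pairs p f K1)"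
  proof (intro ballI iffI)
    fix K1 K2 :: "(complex^'n) set" assume "K1 \<subseteq> K2"
    then show "tight_pairs p f K2 \<subseteq> tight_pairs p f K1" by (fastforce simp: tight_pairs_def)
  next
    fix K1 K2 assume K: "K1 \<in> ?Fs" "K2 \<in> ?Fs" and sub: "tight_pairs p f K2 \<subseteq> tight_pairs p f K1"
    have "face (tight_pairs p f K1) \<subseteq> face (tight_pairs p f K2)" using sub by (auto simp: face_def)
    then show "K1 \<subseteq> K2" using face_tight_pairs K by simp
  qed
qed

lemma empty_graph: "{} \<in> pointed_noncrossing_graphs p"
  by (simp add: pointed_noncrossing_graphs_def is_graph_def non_crossing_def pointed_def
      pointed_at_def neighbours_def)

lemma single_edge_graph:
  assumes "i \<noteq> j"
  shows "{{i, j}} \<in> pointed_noncrossing_graphs p"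
proof -
  have "card (neighbours {{i, j}} k) \<le> 1" for k
  proof -
    have "neighbours {{i, j}} k \<subseteq> {if k = i then j else i}"
      by (auto simp: neighbours_def doubleton_eq_iff)
    then have "card (neighbours {{i, j}} k) \<le> card {if k = i then j else i}"
      by (intro card_mono) auto
    then show ?thesis by simp
  qed
  then have "pointed p {{i, j}}" by (simp add: pointed_def pointed_at_def)
  moreover have "non_crossing p {{i, j}}" 
    unfolding non_crossing_def by (metis singletonD)
  moreover have "is_graph {{i, j}}" using assms by (auto simp: is_graph_def)
  ultimately show ?thesis by (simp add: pointed_noncrossing_graphs_def)
qed

lemma aff_dim_X: "aff_dim X = 2 * int CARD('n) - 3"
  using aff_dim_face[OF empty_graph] by (simp add: face_def)

text \<open>Facets have codimension one, so their tight graphs are single edges; the facets through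
  a vertex \<open>v\<close> therefore correspond to the edges of \<open>E v\<close>.\<close>

lemma simple_X: "simple_polyhedron X"
  unfolding simple_polyhedron_def
proof (intro conjI allI impI)
  show "polyhedron X" by (rule polyhedron_X)
  fix v assume v: "{v} face_of X"
  have Ev: "E v \<in> pointed_noncrossing_graphs p"
    by (rule tight_pairs_pointed_noncrossing[OF v]) simp
  have face_v: "face (E v) = {v}"
    by (rule face_tight_pairs[OF v]) simp
  have graph: "is_graph (E v)" by (rule is_graph_tight_pairs)
  have "v \<in> X" using v by (simp add: face_of_singleton extreme_point_of_def)
  have "{F. F facet_of X \<and> v \<in> F} = (\<lambda>e. face {e}) ` E v"
  proof (intro equalityI subsetI)
    fix F assume "F \<in> {F. F facet_of X \<and> v \<in> F}"
    then have F: "F face_of X" "F \<noteq> {}" "aff_dim F = aff_dim X - 1" "v \<in> F" by (auto simp: facet_of_def)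
    let ?G = "tight_pairs p f F"
    have FG: "face ?G = F" "?G \<in> pointed_noncrossing_graphs p"
      using face_tight_pairs tight_pairs_pointed_noncrossing F by auto
    then have "int (card ?G) = 1" using aff_dim_face[OF FG(2)] F(3) aff_dim_X by simp
    then obtain e where e: "?G = {e}" by (auto simp: card_1_singleton_iff)
    have "?G \<subseteq> E v" using F(4) by (auto simp: tight_pairs_def)
    then show "F \<in> (\<lambda>e. face {e}) ` E v" using e FG(1) by auto
  next
    fix F assume "F \<in> (\<lambda>e. face {e}) ` E v"
    then obtain e where e: "e \<in> E v" "F = face {e}" by blast
    then obtain i j where ij: "e = {i, j}" "i \<noteq> j" using graph by (auto simp: is_graph_def)
    have G: "{e} \<in> pointed_noncrossing_graphs p" using single_edge_graph ij by simp
    have "F face_of X" unfolding e using G by (intro face_face_of) (simp add: pointed_noncrossing_graphs_def)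
    moreover have "F \<noteq> {}" unfolding e by (rule tight_pairs_face(2)[OF G])
    moreover have "aff_dim F = aff_dim X - 1" unfolding e using aff_dim_face[OF G] aff_dim_X by simp
    moreover have "v \<in> F" using e \<open>v \<in> X\<close> by (auto simp: face_def)
    ultimately show "F \<in> {F. F facet_of X \<and> v \<in> F}" by (simp add: facet_of_def)
  qed
  moreover have "inj_on (\<lambda>e. face {e}) (E v)"
  proof (rule inj_onI)
    fix e e' assume e: "e \<in> E v" "e' \<in> E v" "face {e} = face {e'}"
    have G: "{d} \<in> pointed_noncrossing_graphs p" if "d \<in> E v" for d
      using that graph single_edge_graph by (force simp: is_graph_def)
    have "{e} = {e'}"
      using tight_pairs_face(1)[OF G[OF e(1)]] tight_pairs_face(1)[OF G[OF e(2)]] e(3) by metis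
    then show "e = e'" by simp
  qed
  ultimately have "card {F. F facet_of X \<and> v \<in> F} = card (E v)" by (simp add: card_image)
  \<comment> \<open>The face \<open>{v}\<close> has dimension zero, so the dimension formula
    determines the number of its tight edges.\<close>
  moreover have "aff_dim X = int (card (E v))"
    using aff_dim_face[OF Ev] face_v aff_dim_X by simp
  ultimately show "int (card {F. F facet_of X \<and> v \<in> F}) = aff_dim X" by simp
qed

end

theorem theorem3p9:
  fixes a b :: complex and p :: "'n::finite \<Rightarrow> complex" and i1 i2 :: 'n
  assumes "CARD('n) \<ge> 3"
    and "general_position p"
    and "i1 \<noteq> i2" and "Im (p i1) \<noteq> Im (p i2)"
  defines "f \<equiv> (\<lambda>i j. det3 a (p i) (p j) * det3 b (p i) (p j))"
  shows "simple_polyhedron (Xbar p i1 i2 f) \<and>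
         aff_dim (Xbar p i1 i2 f) = 2 * int CARD('n) - 3 \<and>
         valid_choice p i1 i2 f"
proof -
  interpret X: expansion_polyhedron p i1 i2 a b
    using assms(2,4) by (rule expansion_polyhedron.intro)
  have eq: "X.f = f" by (simp only: X.f_def f_def)
  show ?thesis
    by (intro conjI X.simple_X[unfolded eq] X.aff_dim_X[unfolded eq] X.valid_choice[unfolded eq])
qed

end
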